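(* Let $n\ge1$, $s\in(0,1)$, let $\Omega\subset\mathbb R^n$ be a bounded open set with Lipschitz boundary, and let $f\ge0$, $f\in L^1(\Omega)$. (i) Let $E\subset\Omega$ be such that $\chi_E\in\mathcal W_0^{s,1}(\Omega)$ is a minimizer of $\mathcal F_1^s$. Then $E$ is a minimizer of $\mathcal P_s$. (ii) Let $E\subset\Omega$ be a minimizer of $\mathcal P_s$ such that $\mathcal P_s(E)\ge0$. Then $\chi_E$ is a non-negative minimizer of $\mathcal F_1^s$.
   Context: $\mathcal W^{s,1}_0(\Omega)$ is the closure of $C_c^\infty(\Omega)$ in the norm $\|u\|_{W^{s,1}(\Omega)}=\|u\|_{L^1(\Omega)}+\int_\Omega\int_\Omega\frac{|u(x)-u(y)|}{|x-y|^{n+s}}dxdy$, its elements being functions on $\mathbb R^n$ vanishing on $\mathbb R^n\setminus\Omega$ (for Lipschitz bounded $\Omega$ it equals the set of all $u:\mathbb R^n\to\mathbb R$ with $u=0$ on $\mathbb R^n\setminus\Omega$ and finite norm). $\mathcal F_1^s(u)=\frac12\iint_{\mathbb R^{2n}}\frac{|u(x)-u(y)|}{|x-y|^{n+s}}dxdy-\int_\Omega fu\,dx$. A minimizer of $\mathcal F_1^s$ is a $u\in\mathcal W_0^{s,1}(\Omega)$ with $\mathcal F_1^s(u)\le\mathcal F_1^s(v)$ for all $v\in\mathcal W_0^{s,1}(\Omega)$ (for which the integral $\int_\Omega fv$ makes sense in $[-\infty,+\infty]$). A non-negative minimizer is a $u\in\mathcal W_0^{s,1}(\Omega)$, $u\ge0$,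 with $\mathcal F_1^s(u)\le\mathcal F_1^s(v)$ for all $v\in\mathcal W_0^{s,1}(\Omega)$ such that $v\ge0$. $\operatorname{Per}_s(A)=\frac12\iint_{\mathbb R^{2n}}\frac{|\chi_A(x)-\chi_A(y)|}{|x-y|^{n+s}}dxdy$, $|A|_f=\int_Af\,dx$, $\mathcal P_s(E)=\operatorname{Per}_s(E)-|E|_f$. A measurable set $E\subset\Omega$ is a minimizer of $\mathcal P_s$ if $\mathcal P_s(E)\le\mathcal P_s(F)$ for all measurable $F\subset\Omega$. *)

theory Defs
  imports "HOL-Analysis.Analysis"
begin

fun Ck :: "nat \<Rightarrow> (real ^ 'n \<Rightarrow> real) \<Rightarrow> bool" where
  "Ck 0 u \<longleftrightarrow> continuous_on UNIV u"
| "Ck (Suc k) u \<longleftrightarrow>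
     (\<forall>x. u differentiable (at x)) \<and> (\<forall>v. Ck k (\<lambda>x. frechet_derivative u (at x) v))"

definition test_functions :: "(real ^ 'n) set \<Rightarrow> (real ^ 'n \<Rightarrow> real) set" where
  "test_functions \<Omega> =
     {u. (\<forall>k. Ck k u) \<and> compact (closure {x. u x \<noteq> 0}) \<and> closure {x. u x \<noteq> 0} \<subseteq> \<Omega>}"

text \<open>Near each boundary point the set is the region strictly above a Lipschitz graph. The rotated
  coordinate system is given by its vertical axis \<open>\<nu>\<close> and the hyperplane orthogonal to it.\<close>

definition lipschitz_boundary :: "(real ^ 'n) set \<Rightarrow> bool" where
  "lipschitz_boundary \<Omega> \<longleftrightarrow>
     (\<forall>p\<in>frontier \<Omega>. \<exists>r>0. \<exists>\<nu> L g. norm \<nu> = 1 \<and> L-lipschitz_on {z. z \<bullet> \<nu> = 0} (g :: real ^ 'n \<Rightarrow> real) \<and>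
        \<Omega> \<inter> ball p r = {y \<in> ball p r. g (y - (y \<bullet> \<nu>) *\<^sub>R \<nu>) < y \<bullet> \<nu>})"

text \<open>The integrand is \<open>0\<close> on the diagonal, since there it reads \<open>0 / 0\<close>.\<close>

definition gagliardo :: "real \<Rightarrow> (real ^ 'n) set \<Rightarrow> (real ^ 'n \<Rightarrow> real) \<Rightarrow> ennreal" where
  "gagliardo s A u =
     (\<integral>\<^sup>+y\<in>A. (\<integral>\<^sup>+x\<in>A. ennreal (\<bar>u x - u y\<bar> / norm (x - y) powr (real CARD('n) + s)) \<partial>lebesgue) \<partial>lebesgue)"

definition Ws1_norm :: "real \<Rightarrow> (real ^ 'n) set \<Rightarrow> (real ^ 'n \<Rightarrow> real) \<Rightarrow> ennreal" where
  "Ws1_norm s \<Omega> u = (\<integral>\<^sup>+x\<in>\<Omega>. ennreal \<bar>u x\<bar> \<partial>lebesgue) + gagliardo s \<Omega> u"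

text \<open>The approximation property forces \<open>Ws1_norm s \<Omega> u < \<infinity>\<close>, since test functions have finite norm.\<close>

definition Ws1_0 :: "real \<Rightarrow> (real ^ 'n) set \<Rightarrow> (real ^ 'n \<Rightarrow> real) set" where
  "Ws1_0 s \<Omega> =
     {u. u \<in> borel_measurable lebesgue \<and> (\<forall>x. x \<notin> \<Omega> \<longrightarrow> u x = 0) \<and>
         (\<forall>e>0. \<exists>\<phi>\<in>test_functions \<Omega>. Ws1_norm s \<Omega> (\<lambda>x. u x - \<phi> x) < e)}"

text \<open>Since \<open>ennreal\<close> sends negative reals to \<open>0\<close>, the two integrals below are those of the positive
  and of the negative part of \<open>g\<close>.\<close>

definition integral_exists :: "(real ^ 'n) set \<Rightarrow> (real ^ 'n \<Rightarrow> real) \<Rightarrow> bool" where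
  "integral_exists \<Omega> g \<longleftrightarrow>
     (\<integral>\<^sup>+x\<in>\<Omega>. ennreal (g x) \<partial>lebesgue) < \<infinity> \<or> (\<integral>\<^sup>+x\<in>\<Omega>. ennreal (- g x) \<partial>lebesgue) < \<infinity>"

definition extended_integral :: "(real ^ 'n) set \<Rightarrow> (real ^ 'n \<Rightarrow> real) \<Rightarrow> ereal" where
  "extended_integral \<Omega> g =
     enn2ereal (\<integral>\<^sup>+x\<in>\<Omega>. ennreal (g x) \<partial>lebesgue) - enn2ereal (\<integral>\<^sup>+x\<in>\<Omega>. ennreal (- g x) \<partial>lebesgue)"

text \<open>In \<open>ereal\<close>, \<open>\<infinity> - \<infinity> = \<infinity>\<close>. This convention has no effect on the minimization problems
  below: if \<open>\<Omega>\<close> is a bounded Lipschitz open set and \<open>0 < s < 1\<close>, then \<open>gagliardo s UNIV u < \<infinity>\<close> for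
  all \<open>u \<in> Ws1_0 s \<Omega>\<close>, by the fractional Hardy inequality.\<close>

definition F1 :: "real \<Rightarrow> (real ^ 'n) set \<Rightarrow> (real ^ 'n \<Rightarrow> real) \<Rightarrow> (real ^ 'n \<Rightarrow> real) \<Rightarrow> ereal" where
  "F1 s \<Omega> f u = enn2ereal (gagliardo s UNIV u / 2) - extended_integral \<Omega> (\<lambda>x. f x * u x)"

definition F1_minimizer ::
    "real \<Rightarrow> (real ^ 'n) set \<Rightarrow> (real ^ 'n \<Rightarrow> real) \<Rightarrow> (real ^ 'n \<Rightarrow> real) \<Rightarrow> bool" where
  "F1_minimizer s \<Omega> f u \<longleftrightarrow>
     u \<in> Ws1_0 s \<Omega> \<and> integral_exists \<Omega> (\<lambda>x. f x * u x) \<and>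
     (\<forall>v\<in>Ws1_0 s \<Omega>. integral_exists \<Omega> (\<lambda>x. f x * v x) \<longrightarrow> F1 s \<Omega> f u \<le> F1 s \<Omega> f v)"

text \<open>No \<open>integral_exists\<close> condition is needed here when \<open>f\<close> is non-negative.\<close>

definition F1_nonneg_minimizer ::
    "real \<Rightarrow> (real ^ 'n) set \<Rightarrow> (real ^ 'n \<Rightarrow> real) \<Rightarrow> (real ^ 'n \<Rightarrow> real) \<Rightarrow> bool" where
  "F1_nonneg_minimizer s \<Omega> f u \<longleftrightarrow>
     u \<in> Ws1_0 s \<Omega> \<and> (\<forall>x. 0 \<le> u x) \<and>
     (\<forall>v\<in>Ws1_0 s \<Omega>. (\<forall>x. 0 \<le> v x) \<longrightarrow> F1 s \<Omega> f u \<le> F1 s \<Omega> f v)"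

definition Per :: "real \<Rightarrow> (real ^ 'n) set \<Rightarrow> ennreal" where
  "Per s A = gagliardo s UNIV (indicat_real A) / 2"

definition P :: "real \<Rightarrow> (real ^ 'n \<Rightarrow> real) \<Rightarrow> (real ^ 'n) set \<Rightarrow> ereal" where
  "P s f E = enn2ereal (Per s E) - ereal (set_lebesgue_integral lebesgue E f)"

definition P_minimizer :: "real \<Rightarrow> (real ^ 'n) set \<Rightarrow> (real ^ 'n \<Rightarrow> real) \<Rightarrow> (real ^ 'n) set \<Rightarrow> bool" where
  "P_minimizer s \<Omega> f E \<longleftrightarrow>
     E \<in> sets lebesgue \<and> E \<subseteq> \<Omega> \<and> (\<forall>F\<in>sets lebesgue. F \<subseteq> \<Omega> \<longrightarrow> P s f E \<le> P s f F)"

end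

theory Submission
  imports Defs
begin

text \<open>
  For a measurable set \<open>F \<subseteq> \<Omega>\<close> the number \<open>F1 s \<Omega> f (indicat_real F)\<close> is \<open>P s f F\<close>. Both parts rest
  on two facts about how sets compare with functions.

  The first is that the indicator of a set of finite perimeter inside \<open>\<Omega>\<close> is an admissible competitor, that
  is, it can be approximated by test functions (\<open>indicator_in_Ws1_0\<close>, from \<open>Ws1_0_density\<close>). This gives
  the first part at once: a set \<open>F\<close> of infinite perimeter has \<open>P s f F = \<infinity>\<close>, because \<open>f\<close> is integrable,
  and any other \<open>F\<close> can be inserted into the minimality of \<open>indicat_real E\<close>.

  The second is the coarea formula (\<open>frac_seminorm_coarea\<close>): a function \<open>v \<ge> 0\<close> vanishing outside \<open>\<Omega>\<close>
  satisfies, formally, \<open>F1 s \<Omega> f v = \<integral> P s f {x. t < v x} dt\<close> over \<open>t \<ge> 0\<close>. In the second part,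
  \<open>0 \<le> P s f E \<le> P s f {} = 0\<close>, so \<open>P s f\<close> vanishes at \<open>E\<close> and is non-negative on all measurable
  subsets of \<open>\<Omega>\<close>; hence \<open>F1 s \<Omega> f v \<ge> 0 = F1 s \<Omega> f (indicat_real E)\<close> (\<open>F1_nonneg_of_P_nonneg\<close>).

  Density of test functions is proved for every function \<open>u\<close> that vanishes outside \<open>\<Omega>\<close>, is integrable and
  has a finite seminorm over the whole space. Lipschitz cutoffs preserve these properties
  (\<open>frac_norm_cutoff_finite\<close>), so by compactness \<open>u\<close> may be assumed to live in a small ball, either inside
  \<open>\<Omega>\<close> or around a boundary point at which \<open>\<Omega>\<close> is the region above a graph. In the latter case a small
  translation away from the graph moves the support of \<open>u\<close> into \<open>\<Omega>\<close>, and mollification then yields test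
  functions. Translation and mollification are continuous in the fractional norm for a common
  reason (\<open>frac_norm_convergence\<close>): they commute with translations, so that continuity in the mean is
  inherited by all increments, and dominated convergence applies to the seminorm written as an
  integral over increments.
\<close>

section \<open>Continuity of translations in the mean\<close>

definition L1norm :: "('a::euclidean_space \<Rightarrow> real) \<Rightarrow> ennreal" where
  "L1norm w = (\<integral>\<^sup>+x. ennreal \<bar>w x\<bar> \<partial>lborel)"

lemma nn_integral_lborel_shift:
  fixes f :: "'a::euclidean_space \<Rightarrow> ennreal"
  assumes [measurable]: "f \<in> borel_measurable borel"
  shows "(\<integral>\<^sup>+x. f (x + h) \<partial>lborel) = (\<integral>\<^sup>+x. f x \<partial>lborel)"
proof -
  have "(\<integral>\<^sup>+x. f x \<partial>lborel) = (\<integral>\<^sup>+x. f x \<partial>distr lborel borel ((+) h))"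
    by (simp add: lborel_distr_plus)
  also have "\<dots> = (\<integral>\<^sup>+x. f (h + x) \<partial>lborel)"
    by (subst nn_integral_distr) auto
  finally show ?thesis by (simp add: add.commute)
qed

lemma L1norm_shift:
  fixes w :: "'a::euclidean_space \<Rightarrow> real"
  assumes [measurable]: "w \<in> borel_measurable borel"
  shows "L1norm (\<lambda>x. w (x + h)) = L1norm w"
  unfolding L1norm_def by (rule nn_integral_lborel_shift) simp

lemma L1norm_add_le:
  fixes u v :: "'a::euclidean_space \<Rightarrow> real"
  assumes [measurable]: "u \<in> borel_measurable borel" "v \<in> borel_measurable borel"
  shows "L1norm (\<lambda>x. u x + v x) \<le> L1norm u + L1norm v"
  unfolding L1norm_def
  by (subst nn_integral_add[symmetric]) (auto intro!: nn_integral_mono simp flip: ennreal_plus)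

lemma L1norm_uminus: "L1norm (\<lambda>x. - u x) = L1norm u"
  by (simp add: L1norm_def)

lemma L1norm_minus_commute: "L1norm (\<lambda>x. u x - v x) = L1norm (\<lambda>x. v x - u x)"
  by (simp add: L1norm_def abs_minus_commute)

lemma L1norm_diff_le:
  fixes u v :: "'a::euclidean_space \<Rightarrow> real"
  assumes [measurable]: "u \<in> borel_measurable borel" "v \<in> borel_measurable borel"
  shows "L1norm (\<lambda>x. u x - v x) \<le> L1norm u + L1norm v"
  using L1norm_add_le[of u "\<lambda>x. - v x"] by (simp add: L1norm_uminus)

lemma L1norm_increment_le:
  fixes u :: "'a::euclidean_space \<Rightarrow> real"
  assumes [measurable]: "u \<in> borel_measurable borel"
  shows "L1norm (\<lambda>x. u (x + h) - u x) \<le> 2 * L1norm u"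
  using L1norm_diff_le[of "\<lambda>x. u (x + h)" u] by (simp add: L1norm_shift mult_2)

lemma L1norm_finite_iff_integrable:
  fixes u :: "'a::euclidean_space \<Rightarrow> real"
  assumes "u \<in> borel_measurable borel"
  shows "L1norm u < \<infinity> \<longleftrightarrow> integrable lborel u"
  using assms by (auto simp: L1norm_def integrable_iff_bounded)

text \<open>Lets continuity of translations pass from a class of functions to its closure in the mean:
  translating both functions moves their difference without changing its norm.\<close>

lemma L1norm_increment_perturb:
  fixes u v :: "'a::euclidean_space \<Rightarrow> real"
  assumes [measurable]: "u \<in> borel_measurable borel" "v \<in> borel_measurable borel"
  shows "L1norm (\<lambda>x. u (x + h) - u x)
    \<le> L1norm (\<lambda>x. v (x + h) - v x) + 2 * L1norm (\<lambda>x. u x - v x)"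
proof -
  have "L1norm (\<lambda>x. u (x + h) - u x)
    = L1norm (\<lambda>x. (v (x + h) - v x) + ((\<lambda>x. u x - v x) (x + h) - (\<lambda>x. u x - v x) x))"
    by (rule arg_cong[where f = L1norm]) auto
  also have "\<dots> \<le> L1norm (\<lambda>x. v (x + h) - v x) + L1norm (\<lambda>x. (\<lambda>x. u x - v x) (x + h) - (\<lambda>x. u x - v x) x)"
    by (rule L1norm_add_le) measurable
  also have "\<dots> \<le> L1norm (\<lambda>x. v (x + h) - v x) + 2 * L1norm (\<lambda>x. u x - v x)"
    by (intro add_left_mono L1norm_increment_le) measurable
  finally show ?thesis .
qed

lemma tendsto_zero_by_approximation:
  fixes f :: "'b \<Rightarrow> ennreal"
  assumes "\<And>e::real. e > 0 \<Longrightarrow> \<exists>g. (g \<longlongrightarrow> 0) F \<and> (\<forall>h. f h \<le> g h + ennreal e)"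
  shows "(f \<longlongrightarrow> 0) F"
proof (rule order_tendstoI)
  fix a :: ennreal assume "0 < a"
  then obtain e :: real where e: "0 < e" "ennreal e < a"
    using ennreal_rat_dense[of 0 a] by (metis dense ennreal_cases ennreal_less_zero_iff order.strict_trans top.not_eq_extremum)
  from assms[of "e/2"] e obtain g where g: "(g \<longlongrightarrow> 0) F" "\<And>h. f h \<le> g h + ennreal (e/2)" by auto
  have "eventually (\<lambda>h. g h < ennreal (e/2)) F"
    using g(1) e by (intro order_tendstoD) auto
  then show "eventually (\<lambda>h. f h < a) F"
  proof eventually_elim
    case (elim h)
    have "f h \<le> ennreal (e/2) + ennreal (e/2)"
      using g(2)[of h] elim by (meson add_right_mono less_imp_le order_trans)
    also have "\<dots> = ennreal e" using e by (simp flip: ennreal_plus)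
    finally show ?case using e by auto
  qed
qed auto

text \<open>For an open set, points of \<open>U\<close> stay in \<open>U\<close> under small translations, so the part of \<open>U\<close> that
  leaves it tends to zero by dominated convergence. Since \<open>U\<close> and its translate have the same
  finite measure, the part that is gained has the same measure as the part that is lost.\<close>

lemma L1_translation_continuous_open:
  fixes U :: "'a::euclidean_space set"
  assumes U: "open U" "emeasure lborel U < \<infinity>" and h: "h \<longlonglongrightarrow> 0"
  shows "(\<lambda>k. L1norm (\<lambda>x. indicat_real U (x + h k) - indicat_real U x)) \<longlonglongrightarrow> 0"
proof -
  have [measurable]: "U \<in> sets borel" using U by simp
  define J where "J k = (\<integral>\<^sup>+x. indicator U x * (1 - indicator U (x + h k)) \<partial>lborel)" for k
  have "J \<longlonglongrightarrow> (\<integral>\<^sup>+x. 0 \<partial>lborel :: 'a measure)"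
    unfolding J_def
  proof (rule nn_integral_dominated_convergence[where w = "indicator U"])
    show "AE x in lborel. (\<lambda>k. indicator U x * (1 - indicator U (x + h k)) :: ennreal) \<longlonglongrightarrow> 0"
    proof (rule AE_I2)
      fix x :: 'a
      show "(\<lambda>k. indicator U x * (1 - indicator U (x + h k)) :: ennreal) \<longlonglongrightarrow> 0"
      proof (cases "x \<in> U")
        case True
        have "(\<lambda>k. x + h k) \<longlonglongrightarrow> x" using tendsto_add[OF tendsto_const h, of x] by simp
        with U(1) True have "eventually (\<lambda>k. x + h k \<in> U) sequentially"
          by (auto simp: tendsto_def)
        then have "eventually (\<lambda>k. indicator U x * (1 - indicator U (x + h k)) = (0 :: ennreal)) sequentially"
          by eventually_elim simp
        then show ?thesis by (rule tendsto_eventually)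
      qed simp
    qed
    show "(\<integral>\<^sup>+x. indicator U x \<partial>lborel) < \<infinity>" using U(2) by simp
  qed (auto simp: indicator_def)
  then have J: "J \<longlonglongrightarrow> 0" by simp
  have eq: "L1norm (\<lambda>x. indicat_real U (x + h k) - indicat_real U x) = 2 * J k" for k
  proof -
    \<comment> \<open>For values in \<open>{0, 1}\<close>, \<open>\<bar>a - b\<bar> + b = 2 * (b * (1 - a)) + a\<close>; the measure of \<open>U\<close> then cancels.\<close>
    have "L1norm (\<lambda>x. indicat_real U (x + h k) - indicat_real U x) + emeasure lborel U
        = (\<integral>\<^sup>+x. ennreal \<bar>indicat_real U (x + h k) - indicat_real U x\<bar> + indicator U x \<partial>lborel)"
      unfolding L1norm_def by (subst nn_integral_add) auto
    also have "\<dots> = (\<integral>\<^sup>+x. 2 * (indicator U x * (1 - indicator U (x + h k))) + indicator U (x + h k) \<partial>lborel)"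
      by (intro nn_integral_cong) (auto simp: indicator_def one_add_one)
    also have "\<dots> = 2 * J k + emeasure lborel U"
      unfolding J_def
      by (subst nn_integral_add) (auto simp: nn_integral_cmult nn_integral_lborel_shift[of "indicator U"])
    finally show ?thesis using U(2) by (auto simp: add.commute[of _ "emeasure lborel U"] ennreal_add_left_cancel)
  qed
  show ?thesis unfolding eq using tendsto_mult_ennreal[OF tendsto_const J, of 2] by auto
qed

text \<open>Open sets suffice: by outer regularity they approximate every measurable set of finite measure,
  and multiples, sums and limits dominated by an integrable function give all integrable functions.\<close>

proposition L1_translation_continuous_seq:
  fixes w :: "'a::euclidean_space \<Rightarrow> real"
  assumes "integrable lborel w" and h: "h \<longlonglongrightarrow> 0"
  shows "(\<lambda>k. L1norm (\<lambda>x. w (x + h k) - w x)) \<longlonglongrightarrow> 0"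
  using assms(1)
proof (induction rule: integrable_induct)
  case (base A c)
  then have [measurable]: "A \<in> sets borel" by simp
  have ind: "(\<lambda>k. L1norm (\<lambda>x. indicat_real A (x + h k) - indicat_real A x)) \<longlonglongrightarrow> 0"
  proof (rule tendsto_zero_by_approximation)
    fix e :: real assume "e > 0"
    then obtain U where U: "open U" "A \<subseteq> U" "emeasure lborel (U - A) < ennreal (e/2)"
      using outer_regular_lborel[of A "e/2"] base by (metis half_gt_zero sets_lborel)
    have [measurable]: "U \<in> sets borel" using U by simp
    have "emeasure lborel U \<le> emeasure lborel (U - A) + emeasure lborel A"
      using U(2) by (subst plus_emeasure) (auto intro!: emeasure_mono)
    also have "\<dots> < \<infinity>" using U(3) base(2) by (auto simp: less_top[symmetric] top_unique)
    finally have fin: "emeasure lborel U < \<infinity>" .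
    have "L1norm (\<lambda>x. indicat_real A x - indicat_real U x) = (\<integral>\<^sup>+x. indicator (U - A) x \<partial>lborel)"
      unfolding L1norm_def using U(2) by (intro nn_integral_cong) (auto simp: indicator_def)
    then have d: "L1norm (\<lambda>x. indicat_real A x - indicat_real U x) = emeasure lborel (U - A)"
      by simp
    have le: "L1norm (\<lambda>x. indicat_real A (x + h k) - indicat_real A x)
        \<le> L1norm (\<lambda>x. indicat_real U (x + h k) - indicat_real U x) + ennreal e" for k
    proof -
      have "2 * emeasure lborel (U - A) \<le> 2 * ennreal (e/2)"
        using U(3) by (intro mult_left_mono) auto
      also have "\<dots> = ennreal e" using \<open>e > 0\<close> by (simp add: ennreal_mult' mult_2 flip: ennreal_plus)
      finally show ?thesis
        using L1norm_increment_perturb[of "indicat_real A" "indicat_real U" "h k"]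
        unfolding d by (meson add_left_mono order_trans borel_measurable_indicator \<open>A \<in> sets borel\<close> \<open>U \<in> sets borel\<close>)
    qed
    show "\<exists>g. g \<longlonglongrightarrow> 0 \<and> (\<forall>k. L1norm (\<lambda>x. indicat_real A (x + h k) - indicat_real A x) \<le> g k + ennreal e)"
      using L1_translation_continuous_open[OF U(1) fin h] le by blast
  qed
  have "L1norm (\<lambda>x. indicat_real A (x + h k) *\<^sub>R c - indicat_real A x *\<^sub>R c)
      = ennreal \<bar>c\<bar> * L1norm (\<lambda>x. indicat_real A (x + h k) - indicat_real A x)" for k
    unfolding L1norm_def
    by (subst nn_integral_cmult[symmetric])
      (auto intro!: nn_integral_cong simp: abs_mult left_diff_distrib[symmetric] simp flip: ennreal_mult)
  then show ?case
    using tendsto_mult_ennreal[OF tendsto_const ind, of "ennreal \<bar>c\<bar>"] by (simp add: ennreal_zero_neq_top)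
next
  case (add f g)
  have [measurable]: "f \<in> borel_measurable borel" "g \<in> borel_measurable borel"
    using add(1,2)[THEN borel_measurable_integrable] by simp_all
  have le: "L1norm (\<lambda>x. (f (x + h k) + g (x + h k)) - (f x + g x))
      \<le> L1norm (\<lambda>x. f (x + h k) - f x) + L1norm (\<lambda>x. g (x + h k) - g x)" for k
    using L1norm_add_le[of "\<lambda>x. f (x + h k) - f x" "\<lambda>x. g (x + h k) - g x"]
    by (simp add: algebra_simps)
  show ?case
    by (rule tendsto_sandwich[OF _ _ tendsto_const])
      (use tendsto_add[OF add.IH] in \<open>auto intro!: always_eventually le\<close>)
next
  case (lim f s)
  have [measurable]: "f \<in> borel_measurable borel" "s i \<in> borel_measurable borel" for i
    using lim(1,4)[THEN borel_measurable_integrable] by simp_all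
  have "(\<lambda>i. \<integral>\<^sup>+x. ennreal (norm (f x - s i x)) \<partial>lborel) \<longlonglongrightarrow> 0"
  proof (rule nn_integral_dominated_convergence_norm[where w = "\<lambda>x. 2 * norm (f x)"])
    show "(\<integral>\<^sup>+x. ennreal (2 * norm (f x)) \<partial>lborel) < \<infinity>"
      using lim(4) by (simp add: ennreal_mult' nn_integral_cmult integrable_iff_bounded ennreal_mult_less_top)
  qed (use lim in auto)
  then have conv: "(\<lambda>i. L1norm (\<lambda>x. f x - s i x)) \<longlonglongrightarrow> 0"
    by (simp add: L1norm_def)
  show ?case
  proof (rule tendsto_zero_by_approximation)
    fix e :: real assume "e > 0"
    have "eventually (\<lambda>i. L1norm (\<lambda>x. f x - s i x) < ennreal (e/2)) sequentially"
      using conv \<open>e > 0\<close> by (intro order_tendstoD) auto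
    then obtain i where i: "L1norm (\<lambda>x. f x - s i x) < ennreal (e/2)"
      by (auto simp: eventually_sequentially)
    have "L1norm (\<lambda>x. f (x + h k) - f x) \<le> L1norm (\<lambda>x. s i (x + h k) - s i x) + ennreal e" for k
    proof -
      have "2 * L1norm (\<lambda>x. f x - s i x) \<le> 2 * ennreal (e/2)"
        using i by (intro mult_left_mono) auto
      also have "\<dots> = ennreal e" using \<open>e > 0\<close> by (simp add: mult_2 flip: ennreal_plus)
      finally show ?thesis
        using L1norm_increment_perturb[of f "s i" "h k"]
        by (meson add_left_mono order_trans \<open>f \<in> borel_measurable borel\<close> \<open>\<And>i. s i \<in> borel_measurable borel\<close>)
    qed
    then show "\<exists>g. g \<longlonglongrightarrow> 0 \<and> (\<forall>k. L1norm (\<lambda>x. f (x + h k) - f x) \<le> g k + ennreal e)"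
      using lim.IH by blast
  qed
qed

corollary L1_translation_continuous:
  fixes w :: "'a::euclidean_space \<Rightarrow> real"
  assumes "integrable lborel w"
  shows "((\<lambda>h. L1norm (\<lambda>x. w (x + h) - w x)) \<longlongrightarrow> 0) (at 0)"
  unfolding tendsto_at_iff_sequentially
  using L1_translation_continuous_seq[OF assms] by (auto simp: o_def)

section \<open>The fractional Sobolev norm\<close>

text \<open>For a Borel function \<open>w\<close>, \<open>frac_seminorm s w\<close> is the double integral of
  \<open>\<bar>w x - w y\<bar> / norm (x - y) powr (n + s)\<close> over the whole space, written with the increment
  \<open>z = x - y\<close> as outer variable. In this form it is a weighted integral of \<open>L1\<close>-norms of increments,
  and facts about the \<open>L1\<close>-norm carry over to it.\<close>

definition frac_kernel :: "real \<Rightarrow> 'a::euclidean_space \<Rightarrow> ennreal" where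
  "frac_kernel s z = ennreal (1 / norm z powr (real DIM('a) + s))"

definition frac_seminorm :: "real \<Rightarrow> ('a::euclidean_space \<Rightarrow> real) \<Rightarrow> ennreal" where
  "frac_seminorm s w = (\<integral>\<^sup>+z. frac_kernel s z * L1norm (\<lambda>x. w (x + z) - w x) \<partial>lborel)"

definition frac_norm :: "real \<Rightarrow> ('a::euclidean_space \<Rightarrow> real) \<Rightarrow> ennreal" where
  "frac_norm s w = L1norm w + frac_seminorm s w"

lemma measurable_frac_kernel [measurable]: "frac_kernel s \<in> borel_measurable borel"
  unfolding frac_kernel_def[abs_def] by measurable

lemma measurable_L1norm_increment [measurable]:
  fixes w :: "'a::euclidean_space \<Rightarrow> real"
  assumes [measurable]: "w \<in> borel_measurable borel"
  shows "(\<lambda>z. L1norm (\<lambda>x. w (x + z) - w x)) \<in> borel_measurable borel"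
  unfolding L1norm_def by measurable

lemma frac_seminorm_add_le:
  fixes u v :: "'a::euclidean_space \<Rightarrow> real"
  assumes [measurable]: "u \<in> borel_measurable borel" "v \<in> borel_measurable borel"
  shows "frac_seminorm s (\<lambda>x. u x + v x) \<le> frac_seminorm s u + frac_seminorm s v"
proof -
  have le: "L1norm (\<lambda>x. (u (x + z) + v (x + z)) - (u x + v x))
      \<le> L1norm (\<lambda>x. u (x + z) - u x) + L1norm (\<lambda>x. v (x + z) - v x)" for z
    using L1norm_add_le[of "\<lambda>x. u (x + z) - u x" "\<lambda>x. v (x + z) - v x"]
    by (simp add: algebra_simps)
  show ?thesis
    unfolding frac_seminorm_def
    by (subst nn_integral_add[symmetric])
      (auto intro!: nn_integral_mono mult_left_mono le simp flip: distrib_left)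
qed

lemma frac_norm_add_le:
  fixes u v :: "'a::euclidean_space \<Rightarrow> real"
  assumes "u \<in> borel_measurable borel" "v \<in> borel_measurable borel"
  shows "frac_norm s (\<lambda>x. u x + v x) \<le> frac_norm s u + frac_norm s v"
proof -
  have "frac_norm s (\<lambda>x. u x + v x) \<le> (L1norm u + L1norm v) + (frac_seminorm s u + frac_seminorm s v)"
    unfolding frac_norm_def by (intro add_mono L1norm_add_le frac_seminorm_add_le assms)
  then show ?thesis by (simp add: frac_norm_def ac_simps)
qed

text \<open>The criterion behind both approximation steps. For each fixed increment \<open>z\<close> the increments of
  \<open>v k - u\<close> tend to zero in the mean because \<open>v k - u\<close> does; they are dominated by twice the
  increments of \<open>u\<close>, which are integrable against the kernel. Dominated convergence in \<open>z\<close> does the rest.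
  Translations and averages of translations satisfy the bound on increments, as they commute with
  translations and do not enlarge the \<open>L1\<close>-norm.\<close>

proposition frac_norm_convergence:
  fixes u :: "'a::euclidean_space \<Rightarrow> real"
  assumes [measurable]: "u \<in> borel_measurable borel" "\<And>k. v k \<in> borel_measurable borel"
    and fin: "frac_norm s u < \<infinity>"
    and conv: "(\<lambda>k. L1norm (\<lambda>x. v k x - u x)) \<longlonglongrightarrow> 0"
    and le: "\<And>k z. L1norm (\<lambda>x. v k (x + z) - v k x) \<le> L1norm (\<lambda>x. u (x + z) - u x)"
  shows "(\<lambda>k. frac_norm s (\<lambda>x. v k x - u x)) \<longlonglongrightarrow> 0"
proof -
  define D where "D k z = L1norm (\<lambda>x. (v k (x + z) - u (x + z)) - (v k x - u x))" for k z
  define G where "G z = L1norm (\<lambda>x. u (x + z) - u x)" for z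
  have [measurable]: "D k \<in> borel_measurable borel" for k
    using measurable_L1norm_increment[of "\<lambda>x. v k x - u x"] by (simp add: D_def[abs_def])
  have [measurable]: "G \<in> borel_measurable borel"
    unfolding G_def[abs_def] by measurable
  have D1: "D k z \<le> 2 * L1norm (\<lambda>x. v k x - u x)" for k z
    unfolding D_def using L1norm_increment_le[of "\<lambda>x. v k x - u x" z] by simp
  have D2: "D k z \<le> 2 * G z" for k z
  proof -
    have "D k z = L1norm (\<lambda>x. (v k (x + z) - v k x) - (u (x + z) - u x))"
      unfolding D_def by (rule arg_cong[where f = L1norm]) auto
    also have "\<dots> \<le> L1norm (\<lambda>x. v k (x + z) - v k x) + L1norm (\<lambda>x. u (x + z) - u x)"
      by (rule L1norm_diff_le) measurable
    also have "\<dots> \<le> 2 * G z" using le[of k z] by (simp add: G_def mult_2 add_right_mono)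
    finally show ?thesis .
  qed
  have D0: "(\<lambda>k. D k z) \<longlonglongrightarrow> 0" for z
    by (rule tendsto_sandwich[OF _ _ tendsto_const])
      (use tendsto_mult_ennreal[OF tendsto_const conv, of 2] in \<open>auto intro!: always_eventually D1\<close>)
  have "(\<lambda>k. \<integral>\<^sup>+z. frac_kernel s z * D k z \<partial>lborel) \<longlonglongrightarrow> (\<integral>\<^sup>+z. 0 \<partial>lborel :: 'a measure)"
  proof (rule nn_integral_dominated_convergence[where w = "\<lambda>z. 2 * (frac_kernel s z * G z)"])
    show "AE z in lborel. (\<lambda>k. frac_kernel s z * D k z) \<longlonglongrightarrow> 0"
      using tendsto_mult_ennreal[OF tendsto_const D0] by (auto simp: frac_kernel_def)
    show "AE z in lborel. frac_kernel s z * D k z \<le> 2 * (frac_kernel s z * G z)" for k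
      using mult_left_mono[OF D2, of "frac_kernel s _" k] by (auto simp: ac_simps)
    show "(\<integral>\<^sup>+z. 2 * (frac_kernel s z * G z) \<partial>lborel) < \<infinity>"
      using fin by (auto simp: nn_integral_cmult frac_norm_def frac_seminorm_def G_def ennreal_mult_less_top)
  qed auto
  then have "(\<lambda>k. frac_seminorm s (\<lambda>x. v k x - u x)) \<longlonglongrightarrow> 0"
    by (simp add: frac_seminorm_def D_def)
  from tendsto_add[OF conv this] show ?thesis by (simp add: frac_norm_def)
qed

corollary frac_norm_translation_continuous:
  fixes u :: "'a::euclidean_space \<Rightarrow> real"
  assumes [measurable]: "u \<in> borel_measurable borel" and fin: "frac_norm s u < \<infinity>"
    and h: "h \<longlonglongrightarrow> 0"
  shows "(\<lambda>k. frac_norm s (\<lambda>x. u (x + h k) - u x)) \<longlonglongrightarrow> 0"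
proof (rule frac_norm_convergence[OF _ _ fin])
  have "integrable lborel u"
    using fin by (subst L1norm_finite_iff_integrable[symmetric]) (auto simp: frac_norm_def)
  then show "(\<lambda>k. L1norm (\<lambda>x. u (x + h k) - u x)) \<longlonglongrightarrow> 0"
    by (rule L1_translation_continuous_seq[OF _ h])
  show "L1norm (\<lambda>x. u (x + z + h k) - u (x + h k)) \<le> L1norm (\<lambda>x. u (x + z) - u x)" for k z
    using L1norm_shift[of "\<lambda>x. u (x + z) - u x" "h k"] by (simp add: ac_simps)
qed measurable

section \<open>Lipschitz cutoffs\<close>

lemma dyadic_interval:
  fixes x :: real
  assumes "1 \<le> x"
  obtains k :: nat where "2 ^ k \<le> x" "x < 2 ^ Suc k"
proof
  let ?k = "nat \<lfloor>log 2 x\<rfloor>"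
  have nn: "0 \<le> log 2 x" using assms by simp
  have "2 powr real ?k \<le> 2 powr (log 2 x)" using nn by (intro powr_mono) auto
  then show "2 ^ ?k \<le> x" using assms by (subst (asm) powr_realpow) auto
  have "2 powr (log 2 x) < 2 powr real (Suc ?k)" using nn by (intro powr_less_mono) linarith+
  then show "x < 2 ^ Suc ?k" using assms by (subst (asm) powr_realpow) auto
qed

lemma frac_kernel_le:
  fixes z :: "'a::euclidean_space"
  assumes "0 < a" "a \<le> norm z" "0 < s"
  shows "frac_kernel s z \<le> ennreal (a powr - (real DIM('a) + s))"
  unfolding frac_kernel_def powr_minus_divide
  using assms by (intro ennreal_leI divide_left_mono powr_mono2 mult_pos_pos) auto

lemma suminf_geometric_finite:
  fixes c q :: real
  assumes "0 \<le> c" "0 \<le> q" "q < 1"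
  shows "(\<Sum>k. ennreal (c * q ^ k)) < \<infinity>"
proof -
  have "summable (\<lambda>k. c * q ^ k)" using assms by (intro summable_mult summable_geometric) auto
  then have "(\<Sum>k. ennreal (c * q ^ k)) = ennreal (\<Sum>k. c * q ^ k)"
    using assms by (intro suminf_ennreal2) auto
  then show ?thesis by simp
qed

text \<open>On the dyadic shell of radius about \<open>2 powr - k\<close> the kernel times the radius contributes a multiple
  of \<open>2 powr (- (1 - s) * k)\<close>, and on the one of radius about \<open>2 powr k\<close> the kernel contributes a multiple
  of \<open>2 powr (- s * k)\<close>. Both geometric series converge, the first because \<open>s < 1\<close> and the second
  because \<open>0 < s\<close>.\<close>

lemma frac_kernel_truncated_integrable:
  assumes s: "0 < s" "s < 1"
  shows "(\<integral>\<^sup>+z. frac_kernel s z * ennreal (min 1 (norm z)) \<partial>(lborel :: 'a::euclidean_space measure)) < \<infinity>"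
proof -
  let ?n = "real DIM('a)" and ?V = "unit_ball_vol (real DIM('a))"
  define near :: "nat \<Rightarrow> 'a \<Rightarrow> ennreal" where
    "near k z = ennreal (2 powr - real k * (2 powr - real (Suc k)) powr - (?n + s)) * indicator (cball 0 (2 powr - real k)) z" for k z
  define far :: "nat \<Rightarrow> 'a \<Rightarrow> ennreal" where
    "far k z = ennreal ((2 powr real k) powr - (?n + s)) * indicator (cball 0 (2 powr real (Suc k))) z" for k z
  have term_le: "f k \<le> (\<Sum>k. f k)" for f :: "nat \<Rightarrow> ennreal" and k
    using sum_le_suminf[of f "{k}"] by auto
  have pw: "frac_kernel s z * ennreal (min 1 (norm z)) \<le> (\<Sum>k. near k z) + (\<Sum>k. far k z)" for z :: 'a
  proof (cases "z = 0")
    case True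
    then show ?thesis by simp
  next
    case nz: False
    show ?thesis
    proof (cases "norm z \<le> 1")
      case True
      then obtain k where k: "2 ^ k \<le> 1 / norm z" "1 / norm z < 2 ^ Suc k"
        using dyadic_interval[of "1 / norm z"] nz by auto
      have "norm z \<le> 1 / 2 ^ k" "1 / 2 ^ Suc k \<le> norm z"
        using k nz by (simp_all add: field_simps)
      then have 1: "norm z \<le> 2 powr - real k" and 2: "2 powr - real (Suc k) \<le> norm z"
        by (simp_all only: powr_minus_divide powr_realpow zero_less_numeral)
      have "frac_kernel s z * ennreal (min 1 (norm z))
          \<le> ennreal ((2 powr - real (Suc k)) powr - (?n + s)) * ennreal (2 powr - real k)"
        using 1 2 s by (intro mult_mono frac_kernel_le ennreal_leI) auto
      also have "\<dots> = near k z"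
        using 1 by (simp add: near_def ennreal_mult[symmetric] mult.commute)
      also have "\<dots> \<le> (\<Sum>k. near k z)" by (rule term_le)
      finally show ?thesis by (simp add: add_increasing2)
    next
      case False
      then obtain k where k: "2 ^ k \<le> norm z" "norm z < 2 ^ Suc k"
        using dyadic_interval[of "norm z"] by auto
      then have 1: "2 powr real k \<le> norm z" and 2: "norm z \<le> 2 powr real (Suc k)"
        by (simp_all add: powr_realpow powr_add)
      have "frac_kernel s z * ennreal (min 1 (norm z)) \<le> ennreal ((2 powr real k) powr - (?n + s)) * 1"
        using 1 s False by (intro mult_mono frac_kernel_le) auto
      also have "\<dots> = far k z"
        using 2 by (simp add: far_def)
      also have "\<dots> \<le> (\<Sum>k. far k z)" by (rule term_le)
      finally show ?thesis by (simp add: add_increasing)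
    qed
  qed
  have "(\<integral>\<^sup>+z. near k z \<partial>lborel) = ennreal (?V * 2 powr (?n + s) * (2 powr (s - 1)) ^ k)" for k
  proof -
    have "(\<integral>\<^sup>+z. near k z \<partial>lborel)
        = ennreal (2 powr - real k * (2 powr - real (Suc k)) powr - (?n + s)) * ennreal (?V * (2 powr - real k) ^ DIM('a))"
      unfolding near_def by (subst nn_integral_cmult_indicator) (auto simp: emeasure_cball)
    also have "\<dots> = ennreal (?V * (2 powr - real k * (2 powr - real (Suc k)) powr - (?n + s) * (2 powr - real k) ^ DIM('a)))"
      by (subst ennreal_mult[symmetric]) (auto simp: mult_ac)
    also have "2 powr - real k * (2 powr - real (Suc k)) powr - (?n + s) * (2 powr - real k) ^ DIM('a)
        = 2 powr (?n + s) * (2 powr (s - 1)) ^ k"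
      by (simp add: powr_realpow[symmetric] powr_powr powr_add[symmetric] algebra_simps)
    finally show ?thesis by (simp add: mult.assoc)
  qed
  moreover have "(\<integral>\<^sup>+z. far k z \<partial>lborel) = ennreal (?V * 2 powr ?n * (2 powr - s) ^ k)" for k
  proof -
    have "(\<integral>\<^sup>+z. far k z \<partial>lborel)
        = ennreal ((2 powr real k) powr - (?n + s)) * ennreal (?V * (2 powr real (Suc k)) ^ DIM('a))"
      unfolding far_def by (subst nn_integral_cmult_indicator) (auto simp: emeasure_cball)
    also have "\<dots> = ennreal (?V * ((2 powr real k) powr - (?n + s) * (2 powr real (Suc k)) ^ DIM('a)))"
      by (subst ennreal_mult[symmetric]) (auto simp: mult_ac)
    also have "(2 powr real k) powr - (?n + s) * (2 powr real (Suc k)) ^ DIM('a) = 2 powr ?n * (2 powr - s) ^ k"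
      by (simp add: powr_realpow[symmetric] powr_powr powr_add[symmetric] algebra_simps)
    finally show ?thesis by (simp add: mult.assoc)
  qed
  moreover have "(\<integral>\<^sup>+z. frac_kernel s z * ennreal (min 1 (norm z)) \<partial>(lborel :: 'a measure))
      \<le> (\<Sum>k. \<integral>\<^sup>+z. near k z \<partial>lborel) + (\<Sum>k. \<integral>\<^sup>+z. far k z \<partial>lborel)"
  proof -
    have [measurable]: "near k \<in> borel_measurable borel" "far k \<in> borel_measurable borel" for k
      unfolding near_def[abs_def] far_def[abs_def]
      by (intro borel_measurable_times_ennreal borel_measurable_const borel_measurable_indicator borel_closed closed_cball)+
    have "(\<integral>\<^sup>+z. frac_kernel s z * ennreal (min 1 (norm z)) \<partial>(lborel :: 'a measure))
        \<le> (\<integral>\<^sup>+z. (\<Sum>k. near k z) + (\<Sum>k. far k z) \<partial>lborel)"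
      by (intro nn_integral_mono pw)
    then show ?thesis
      by (simp add: nn_integral_add nn_integral_suminf)
  qed
  moreover have "(\<Sum>k. ennreal (?V * 2 powr (?n + s) * (2 powr (s - 1)) ^ k)) < \<infinity>"
    using s powr_less_mono[of "s - 1" 0 2]
    by (intro suminf_geometric_finite) auto
  moreover have "(\<Sum>k. ennreal (?V * 2 powr ?n * (2 powr - s) ^ k)) < \<infinity>"
    using s powr_less_mono[of "- s" 0 2]
    by (intro suminf_geometric_finite) auto
  ultimately show ?thesis by (auto simp: order.strict_trans1 less_top[symmetric] top_unique)
qed

text \<open>The product rule for increments leaves, besides the increments of \<open>u\<close>, the increments of \<open>\<eta>\<close>
  times \<open>u\<close>. The increments of \<open>\<eta>\<close> are bounded by a multiple of \<open>min 1 (norm z)\<close>, against which the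
  kernel is integrable.\<close>

proposition frac_norm_cutoff_finite:
  fixes u \<eta> :: "'a::euclidean_space \<Rightarrow> real"
  assumes s: "0 < s" "s < 1"
    and [measurable]: "u \<in> borel_measurable borel" and fin: "frac_norm s u < \<infinity>"
    and \<eta>: "L-lipschitz_on UNIV \<eta>" and bd: "\<And>x. \<bar>\<eta> x\<bar> \<le> 1"
  shows "frac_norm s (\<lambda>x. \<eta> x * u x) < \<infinity>"
proof -
  have [measurable]: "\<eta> \<in> borel_measurable borel"
    using lipschitz_on_continuous_on[OF \<eta>] by (rule borel_measurable_continuous_onI)
  have L0: "0 \<le> L" by (rule lipschitz_on_nonneg[OF \<eta>])
  define C where "C = max 2 L"
  have C: "\<bar>\<eta> (x + z) - \<eta> x\<bar> \<le> C * min 1 (norm z)" for x z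
  proof -
    have "\<bar>\<eta> (x + z) - \<eta> x\<bar> \<le> L * norm z"
      using lipschitz_onD[OF \<eta>, of "x + z" x] by (simp add: dist_norm)
    moreover have "\<bar>\<eta> (x + z) - \<eta> x\<bar> \<le> 2" using bd[of "x + z"] bd[of x] by linarith
    moreover have "L * norm z \<le> C * norm z" "2 \<le> C" by (auto simp: C_def mult_right_mono)
    ultimately show ?thesis by (auto simp: min_def)
  qed
  have 1: "L1norm (\<lambda>x. \<eta> x * u x) \<le> L1norm u"
    unfolding L1norm_def by (intro nn_integral_mono ennreal_leI) (simp add: abs_mult mult_left_le_one_le bd)
  have 2: "L1norm (\<lambda>x. \<eta> (x + z) * u (x + z) - \<eta> x * u x)
      \<le> L1norm (\<lambda>x. u (x + z) - u x) + ennreal (C * min 1 (norm z)) * L1norm u" for z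
  proof -
    have "L1norm (\<lambda>x. \<eta> (x + z) * u (x + z) - \<eta> x * u x)
        \<le> (\<integral>\<^sup>+x. ennreal \<bar>u (x + z) - u x\<bar> + ennreal (C * min 1 (norm z)) * ennreal \<bar>u x\<bar> \<partial>lborel)"
      unfolding L1norm_def
    proof (rule nn_integral_mono)
      fix x
      have "\<bar>\<eta> (x + z) * u (x + z) - \<eta> x * u x\<bar>
          = \<bar>\<eta> (x + z) * (u (x + z) - u x) + (\<eta> (x + z) - \<eta> x) * u x\<bar>" by (simp add: algebra_simps)
      also have "\<dots> \<le> \<bar>\<eta> (x + z)\<bar> * \<bar>u (x + z) - u x\<bar> + \<bar>\<eta> (x + z) - \<eta> x\<bar> * \<bar>u x\<bar>"
        by (metis abs_mult abs_triangle_ineq)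
      also have "\<dots> \<le> \<bar>u (x + z) - u x\<bar> + (C * min 1 (norm z)) * \<bar>u x\<bar>"
        by (intro add_mono mult_right_mono C mult_left_le_one_le bd) auto
      finally show "ennreal \<bar>\<eta> (x + z) * u (x + z) - \<eta> x * u x\<bar>
          \<le> ennreal \<bar>u (x + z) - u x\<bar> + ennreal (C * min 1 (norm z)) * ennreal \<bar>u x\<bar>"
        using L0 by (simp add: C_def flip: ennreal_plus ennreal_mult)
    qed
    also have "\<dots> = L1norm (\<lambda>x. u (x + z) - u x) + ennreal (C * min 1 (norm z)) * L1norm u"
      unfolding L1norm_def by (subst nn_integral_add) (auto simp: nn_integral_cmult)
    finally show ?thesis .
  qed
  have "frac_seminorm s (\<lambda>x. \<eta> x * u x)
      \<le> (\<integral>\<^sup>+z. frac_kernel s z * (L1norm (\<lambda>x. u (x + z) - u x) + ennreal (C * min 1 (norm z)) * L1norm u) \<partial>lborel)"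
    unfolding frac_seminorm_def by (intro nn_integral_mono mult_left_mono 2) auto
  also have "\<dots> = frac_seminorm s u
      + (\<integral>\<^sup>+z. (frac_kernel s z * ennreal (min 1 (norm z))) * (ennreal C * L1norm u) \<partial>(lborel :: 'a measure))"
  proof -
    have "0 \<le> C" by (simp add: C_def)
    then have eq: "frac_kernel s z * (L1norm (\<lambda>x. u (x + z) - u x) + ennreal (C * min 1 (norm z)) * L1norm u)
        = frac_kernel s z * L1norm (\<lambda>x. u (x + z) - u x)
          + (frac_kernel s z * ennreal (min 1 (norm z))) * (ennreal C * L1norm u)" for z :: 'a
      by (simp add: distrib_left ennreal_mult ac_simps)
    show ?thesis
      unfolding frac_seminorm_def eq by (intro nn_integral_add) measurable
  qed
  also have "\<dots> < \<infinity>"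
    using fin frac_kernel_truncated_integrable[OF s, where 'a = 'a]
    by (subst nn_integral_multc) (auto simp: frac_norm_def ennreal_mult_less_top)
  finally show ?thesis
    using 1 fin by (auto simp: frac_norm_def intro: order.strict_trans1)
qed

section \<open>Smooth mollifiers\<close>

text \<open>The functions \<open>exp (- 1 / t) / t ^ m\<close>, extended by zero to the left of the origin. The family over
  all \<open>m\<close> is used since, up to linear combinations, it is closed under differentiation.\<close>

definition flat_exp :: "nat \<Rightarrow> real \<Rightarrow> real" where
  "flat_exp m t = (if 0 < t then exp (- 1 / t) / t ^ m else 0)"

lemma flat_exp_nonneg: "0 \<le> flat_exp m t"
  by (simp add: flat_exp_def)

text \<open>From \<open>exp x \<ge> (1 + x / k) ^ k\<close> with \<open>x = 1 / t\<close> and \<open>k = m + 2\<close>. A quadratic bound is what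
  makes the derivative at the origin vanish.\<close>

lemma flat_exp_le_square:
  "\<bar>flat_exp m t\<bar> \<le> real (m + 2) ^ (m + 2) * t\<^sup>2"
proof (cases "0 < t")
  case True
  let ?k = "m + 2"
  have "(1 / (?k * t)) ^ ?k \<le> (1 + (1 / t) / ?k) ^ ?k"
    using True by (intro power_mono) (auto simp: field_simps)
  also have "\<dots> \<le> exp (1 / t)"
    using True by (intro exp_ge_one_plus_x_over_n_power_n) (auto intro: order_trans[of _ 0])
  finally have "inverse (exp (1 / t)) \<le> inverse ((1 / (?k * t)) ^ ?k)"
    using True by (intro le_imp_inverse_le zero_less_power) auto
  then have "exp (- 1 / t) \<le> (?k * t) ^ ?k"
    by (simp add: exp_minus[symmetric] power_inverse[symmetric] del: of_nat_add power_Suc)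
  then have "exp (- 1 / t) / t ^ m \<le> (?k * t) ^ ?k / t ^ m"
    using True by (intro divide_right_mono) auto
  also have "\<dots> = real ?k ^ ?k * t\<^sup>2"
    using True by (simp add: power_mult_distrib power_add power2_eq_square)
  finally show ?thesis using True by (simp add: flat_exp_def)
qed (simp add: flat_exp_def)

lemma flat_exp_has_derivative:
  "(flat_exp m has_real_derivative flat_exp (m + 2) t - real m * flat_exp (m + 1) t) (at t)"
proof -
  consider "t < 0" | "t = 0" | "0 < t" by linarith
  then show ?thesis
  proof cases
    case 1
    have "((\<lambda>_. 0) has_real_derivative 0) (at t)" by simp
    then have "(flat_exp m has_real_derivative 0) (at t)"
      by (rule has_field_derivative_transform_within_open[where S = "{..<0}"])
        (use 1 in \<open>auto simp: flat_exp_def\<close>)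
    then show ?thesis using 1 by (simp add: flat_exp_def)
  next
    case 2
    let ?C = "real (m + 2) ^ (m + 2)"
    have "((\<lambda>h. flat_exp m h / h) \<longlongrightarrow> 0) (at 0)"
    proof (rule Lim_null_comparison)
      have "norm (flat_exp m h / h) \<le> ?C * \<bar>h\<bar>" for h
      proof (cases "h = 0")
        case False
        then show ?thesis
          using flat_exp_le_square[of m h]
          by (simp add: abs_divide field_simps power2_eq_square del: of_nat_add)
      qed simp
      then show "eventually (\<lambda>h. norm (flat_exp m h / h) \<le> ?C * \<bar>h\<bar>) (at 0)"
        by (intro always_eventually allI)
      show "((\<lambda>h. ?C * \<bar>h\<bar>) \<longlongrightarrow> 0) (at (0::real))"
        by (auto intro!: tendsto_eq_intros)
    qed
    then show ?thesis using 2 by (simp add: DERIV_def flat_exp_def)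
  next
    case 3
    have "((\<lambda>t. exp (- 1 / t) / t ^ m) has_real_derivative
        (exp (- 1 / t) * (1 / t\<^sup>2) * t ^ m - exp (- 1 / t) * (real m * t ^ (m - 1))) / (t ^ m * t ^ m)) (at t)"
      using 3 by (auto intro!: derivative_eq_intros simp: power2_eq_square)
    also have "(exp (- 1 / t) * (1 / t\<^sup>2) * t ^ m - exp (- 1 / t) * (real m * t ^ (m - 1))) / (t ^ m * t ^ m)
        = flat_exp (m + 2) t - real m * flat_exp (m + 1) t"
      using 3 by (cases m) (auto simp: flat_exp_def field_simps power2_eq_square)
    finally have "((\<lambda>t. exp (- 1 / t) / t ^ m) has_real_derivative
        flat_exp (m + 2) t - real m * flat_exp (m + 1) t) (at t)" .
    then show ?thesis
      by (rule has_field_derivative_transform_within_open[where S = "{0<..}"])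
        (use 3 in \<open>auto simp: flat_exp_def\<close>)
  qed
qed

text \<open>For \<open>r \<ge> 0\<close> a class of functions, supported in the closed ball of radius \<open>r\<close>, that contains the
  standard bump and all its iterated directional derivatives: sums of polynomials times \<open>flat_exp m (r\<^sup>2 - x \<bullet> x)\<close>. Closure
  under directional derivatives replaces any bookkeeping of higher derivatives.\<close>

inductive bump_class :: "real \<Rightarrow> ('a::euclidean_space \<Rightarrow> real) \<Rightarrow> bool" for r :: real where
  flat: "bump_class r (\<lambda>x. flat_exp m (r\<^sup>2 - x \<bullet> x))"
| linear: "bump_class r f \<Longrightarrow> bump_class r (\<lambda>x. (x \<bullet> a) * f x)"
| scale: "bump_class r f \<Longrightarrow> bump_class r (\<lambda>x. c * f x)"
| add: "bump_class r f \<Longrightarrow> bump_class r g \<Longrightarrow> bump_class r (\<lambda>x. f x + g x)"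

lemma bump_class_derivative:
  assumes "bump_class r f"
  shows "\<exists>D. (\<forall>x. (f has_derivative D x) (at x)) \<and> (\<forall>v. bump_class r (\<lambda>x. D x v))"
  using assms
proof induction
  case (flat m)
  let ?d = "\<lambda>x. flat_exp (m + 2) (r\<^sup>2 - x \<bullet> x) + - real m * flat_exp (m + 1) (r\<^sup>2 - x \<bullet> x)"
  have "((\<lambda>x. flat_exp m (r\<^sup>2 - x \<bullet> x)) has_derivative (\<lambda>v. - 2 * ((x \<bullet> v) * ?d x))) (at x)" for x :: 'a
  proof -
    have "((\<lambda>x. r\<^sup>2 - x \<bullet> x) has_derivative (\<lambda>v. - 2 * (x \<bullet> v))) (at x)"
      by (auto intro!: derivative_eq_intros simp: inner_commute)
    from has_derivative_compose[OF this flat_exp_has_derivative[THEN has_field_derivative_imp_has_derivative, of m]]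
    show ?thesis by (simp add: algebra_simps)
  qed
  moreover have "bump_class r (\<lambda>x. - 2 * ((x \<bullet> v) * ?d x))" for v :: 'a
    by (intro bump_class.intros)
  ultimately show ?case
    by (intro exI[of _ "\<lambda>x v. - 2 * ((x \<bullet> v) * ?d x)"] conjI allI)
next
  case (linear f a)
  then obtain D where D: "\<And>x. (f has_derivative D x) (at x)" "\<And>v. bump_class r (\<lambda>x. D x v)" by auto
  have "((\<lambda>x. (x \<bullet> a) * f x) has_derivative (\<lambda>v. (x \<bullet> a) * D x v + (v \<bullet> a) * f x)) (at x)" for x
    by (auto intro!: derivative_eq_intros D)
  moreover have "bump_class r (\<lambda>x. (x \<bullet> a) * D x v + (v \<bullet> a) * f x)" for v
    by (intro bump_class.intros D linear)
  ultimately show ?case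
    by (intro exI[of _ "\<lambda>x v. (x \<bullet> a) * D x v + (v \<bullet> a) * f x"] conjI allI)
next
  case (scale f c)
  then obtain D where D: "\<And>x. (f has_derivative D x) (at x)" "\<And>v. bump_class r (\<lambda>x. D x v)" by auto
  have "((\<lambda>x. c * f x) has_derivative (\<lambda>v. c * D x v)) (at x)" for x
    by (auto intro!: derivative_eq_intros D)
  moreover have "bump_class r (\<lambda>x. c * D x v)" for v
    by (intro bump_class.intros D)
  ultimately show ?case
    by (intro exI[of _ "\<lambda>x v. c * D x v"] conjI allI)
next
  case (add f g)
  then obtain D E where D: "\<And>x. (f has_derivative D x) (at x)" "\<And>v. bump_class r (\<lambda>x. D x v)"
    and E: "\<And>x. (g has_derivative E x) (at x)" "\<And>v. bump_class r (\<lambda>x. E x v)" by metis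
  have "((\<lambda>x. f x + g x) has_derivative (\<lambda>v. D x v + E x v)) (at x)" for x
    by (auto intro!: derivative_eq_intros D E)
  moreover have "bump_class r (\<lambda>x. D x v + E x v)" for v
    by (intro bump_class.intros D E)
  ultimately show ?case
    by (intro exI[of _ "\<lambda>x v. D x v + E x v"] conjI allI)
qed

lemma bump_class_continuous: "bump_class r f \<Longrightarrow> continuous_on A f"
  using bump_class_derivative[of r f]
  by (metis has_derivative_continuous continuous_at_imp_continuous_on)

lemma bump_class_eq_0:
  assumes "bump_class r f" "0 \<le> r" "r \<le> norm x"
  shows "f x = 0"
  using assms
proof induction
  case (flat m)
  then have "r\<^sup>2 \<le> x \<bullet> x" by (simp add: power2_norm_eq_inner[symmetric] power_mono)
  then show ?case by (simp add: flat_exp_def)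
qed auto

lemma bump_class_bounded:
  assumes f: "bump_class r f" and r: "0 \<le> r"
  obtains B where "0 \<le> B" "\<And>x. \<bar>f x\<bar> \<le> B"
proof -
  have "compact (f ` cball 0 r)"
    by (intro compact_continuous_image bump_class_continuous[OF f] compact_cball)
  then obtain B where "\<forall>x\<in>cball 0 r. \<bar>f x\<bar> \<le> B"
    by (auto dest!: compact_imp_bounded simp: bounded_iff)
  then have B: "\<bar>f x\<bar> \<le> B" if "x \<in> cball 0 r" for x
    using that by blast
  have "\<bar>f x\<bar> \<le> max 0 B" for x
    using B[of x] bump_class_eq_0[OF f r, of x] by (cases "norm x \<le> r") auto
  then show ?thesis using that[of "max 0 B"] by auto
qed

lemma linear_functional_bound:
  fixes D :: "'a::euclidean_space \<Rightarrow> real"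
  assumes "linear D"
  shows "\<bar>D h\<bar> \<le> (\<Sum>b\<in>Basis. \<bar>D b\<bar>) * norm h"
proof -
  have "D h = D (\<Sum>b\<in>Basis. (h \<bullet> b) *\<^sub>R b)" by (simp add: euclidean_representation)
  also have "\<dots> = (\<Sum>b\<in>Basis. (h \<bullet> b) * D b)"
    using assms by (simp add: linear_sum linear_cmul)
  finally have "\<bar>D h\<bar> \<le> (\<Sum>b\<in>Basis. \<bar>h \<bullet> b\<bar> * \<bar>D b\<bar>)"
    by (metis (no_types, lifting) abs_mult sum.cong sum_abs)
  also have "\<dots> \<le> (\<Sum>b\<in>Basis. norm h * \<bar>D b\<bar>)"
    by (intro sum_mono mult_right_mono Basis_le_norm) auto
  finally show ?thesis by (simp add: sum_distrib_left mult.commute)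
qed

text \<open>The partial derivatives belong to the class again, hence are bounded.\<close>

lemma bump_class_Lipschitz:
  assumes f: "bump_class r f" and r: "0 \<le> r"
  obtains L where "0 \<le> L" "\<And>x y. \<bar>f x - f y\<bar> \<le> L * norm (x - y)"
proof -
  obtain D where D: "\<And>x. (f has_derivative D x) (at x)" "\<And>v. bump_class r (\<lambda>x. D x v)"
    using bump_class_derivative[OF f] by blast
  have "\<exists>B. 0 \<le> B \<and> (\<forall>x. \<bar>D x b\<bar> \<le> B)" for b
    using bump_class_bounded[OF D(2) r, of b] by metis
  then obtain B where B: "\<And>b. 0 \<le> B b" "\<And>b x. \<bar>D x b\<bar> \<le> B b" by metis
  have on: "onorm (D x) \<le> (\<Sum>b\<in>Basis. B b)" for x
  proof (rule onorm_le)
    fix h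
    have "\<bar>D x h\<bar> \<le> (\<Sum>b\<in>Basis. \<bar>D x b\<bar>) * norm h"
      using has_derivative_linear[OF D(1)] by (rule linear_functional_bound)
    also have "\<dots> \<le> (\<Sum>b\<in>Basis. B b) * norm h"
      by (intro mult_right_mono sum_mono B) auto
    finally show "norm (D x h) \<le> (\<Sum>b\<in>Basis. B b) * norm h" by simp
  qed
  have "\<bar>f x - f y\<bar> \<le> (\<Sum>b\<in>Basis. B b) * norm (x - y)" for x y
    using differentiable_bound[of UNIV f D "\<Sum>b\<in>Basis. B b" x y] D(1) on by simp
  then show ?thesis using that[of "\<Sum>b\<in>Basis. B b"] B by (auto simp: sum_nonneg)
qed

text \<open>The partial derivatives belong to the class again, hence are Lipschitz. The bound is uniform in
  \<open>x\<close>, which is what allows differentiation under an integral.\<close>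

lemma bump_class_Taylor:
  assumes f: "bump_class r f" and r: "0 \<le> r"
  obtains D K where "\<And>x. (f has_derivative D x) (at x)" "\<And>v. bump_class r (\<lambda>x. D x v)"
    "0 \<le> K" "\<And>x h. \<bar>f (x + h) - f x - D x h\<bar> \<le> K * (norm h)\<^sup>2"
proof -
  obtain D where D: "\<And>x. (f has_derivative D x) (at x)" "\<And>v. bump_class r (\<lambda>x. D x v)"
    using bump_class_derivative[OF f] by blast
  have "\<exists>L. 0 \<le> L \<and> (\<forall>x y. \<bar>D x b - D y b\<bar> \<le> L * norm (x - y))" for b
    using bump_class_Lipschitz[OF D(2) r, of b] by metis
  then obtain L where L: "\<And>b. 0 \<le> L b" "\<And>b x y. \<bar>D x b - D y b\<bar> \<le> L b * norm (x - y)" by metis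
  define K where "K = (\<Sum>b\<in>Basis. L b)"
  have K0: "0 \<le> K" by (simp add: K_def L sum_nonneg)
  have "\<bar>f (x + h) - f x - D x h\<bar> \<le> K * (norm h)\<^sup>2" for x h
  proof -
    have on: "onorm (D y - D x) \<le> K * norm h" if y: "y \<in> cball x (norm h)" for y
    proof (rule onorm_le)
      fix v
      have lin: "linear (D y - D x)"
        unfolding fun_diff_def by (intro linear_compose_sub has_derivative_linear[OF D(1)])
      have "\<bar>(D y - D x) v\<bar> \<le> (\<Sum>b\<in>Basis. \<bar>(D y - D x) b\<bar>) * norm v"
        using lin by (rule linear_functional_bound)
      also have "\<dots> \<le> (\<Sum>b\<in>Basis. L b * norm h) * norm v"
      proof (intro mult_right_mono sum_mono)
        fix b
        have "\<bar>(D y - D x) b\<bar> \<le> L b * norm (y - x)" using L(2) by simp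
        also have "\<dots> \<le> L b * norm h"
          using y L(1) by (intro mult_left_mono) (auto simp: dist_norm norm_minus_commute)
        finally show "\<bar>(D y - D x) b\<bar> \<le> L b * norm h" .
      qed auto
      finally show "norm ((D y - D x) v) \<le> K * norm h * norm v"
        by (simp add: K_def sum_distrib_right)
    qed
    have "norm (f (x + h) - f x - D x (x + h - x)) \<le> norm (x + h - x) * (K * norm h)"
    proof (rule differentiable_bound_linearization[where S = "cball x (norm h)" and f' = D])
      show "x + t *\<^sub>R (x + h - x) \<in> cball x (norm h)" if "t \<in> {0..1}" for t
        using that by (simp add: dist_norm mult_left_le_one_le)
    qed (auto intro: has_derivative_at_withinI D on)
    then show ?thesis by (simp add: power2_eq_square ac_simps)
  qed
  with D K0 show ?thesis using that[of D K] by blast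
qed

text \<open>For an even function \<open>f\<close> this is the convolution of \<open>f\<close> and \<open>w\<close>. Correlating instead of convolving
  expresses the result as an average of translates of \<open>w\<close> without a reflection of the variable.\<close>

definition correlate :: "('a::euclidean_space \<Rightarrow> real) \<Rightarrow> ('a \<Rightarrow> real) \<Rightarrow> 'a \<Rightarrow> real" where
  "correlate f w x = (\<integral>y. f (y - x) * w y \<partial>lborel)"

lemma integrable_bump_mult:
  fixes w :: "'a::euclidean_space \<Rightarrow> real"
  assumes f: "bump_class r f" and r: "0 \<le> r" and w: "integrable lborel w"
  shows "integrable lborel (\<lambda>y. f (y - x) * w y)"
proof -
  obtain B where B: "\<And>x. \<bar>f x\<bar> \<le> B" using bump_class_bounded[OF f r] by metis
  have [measurable]: "f \<in> borel_measurable borel"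
    using bump_class_continuous[OF f] by (rule borel_measurable_continuous_onI)
  have [measurable]: "w \<in> borel_measurable borel"
    using borel_measurable_integrable[OF w] by simp
  show ?thesis
  proof (rule Bochner_Integration.integrable_bound[of _ "\<lambda>y. B * w y"])
    have "\<bar>f (y - x)\<bar> * \<bar>w y\<bar> \<le> \<bar>B\<bar> * \<bar>w y\<bar>" for y
      using B[of "y - x"] by (intro mult_right_mono) auto
    then show "AE y in lborel. norm (f (y - x) * w y) \<le> norm (B * w y)"
      by (simp add: abs_mult)
  qed (use w in auto)
qed

text \<open>The Taylor remainder of \<open>f\<close> is at most \<open>K * (norm h)\<^sup>2\<close> uniformly, so that of the correlation is at
  most \<open>K * (norm h)\<^sup>2\<close> times the \<open>L1\<close>-norm of \<open>w\<close>. The derivative of \<open>f\<close> enters with a minus sign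
  because \<open>x\<close> occurs as \<open>y - x\<close>.\<close>

lemma correlate_has_derivative:
  fixes w :: "'a::euclidean_space \<Rightarrow> real"
  assumes f: "bump_class r f" and r: "0 \<le> r" and w: "integrable lborel w"
  obtains D where "\<And>x. (correlate f w has_derivative (\<lambda>v. correlate (\<lambda>z. D z v) w x)) (at x)"
    "\<And>v. bump_class r (\<lambda>z. D z v)"
proof -
  obtain D K where D: "\<And>x. (f has_derivative D x) (at x)" "\<And>v. bump_class r (\<lambda>x. D x v)"
    and K: "0 \<le> K" "\<And>x h. \<bar>f (x + h) - f x - D x h\<bar> \<le> K * (norm h)\<^sup>2"
    using bump_class_Taylor[OF f r] by metis
  define E where "E z v = (- 1) * D z v" for z v
  have E: "bump_class r (\<lambda>z. E z v)" for v
    unfolding E_def by (intro bump_class.scale D)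
  have linE: "linear (E z)" for z
    unfolding E_def using has_derivative_linear[OF D(1)]
    by (auto intro!: linear_compose_neg)
  have [simp]: "integrable lborel (\<lambda>y. f (y - x) * w y)" "integrable lborel (\<lambda>y. E (y - x) v * w y)" for x v
    using integrable_bump_mult[OF f r w] integrable_bump_mult[OF E r w] by auto
  let ?M = "\<integral>y. \<bar>w y\<bar> \<partial>lborel"
  have M: "0 \<le> ?M" by simp
  have "(correlate f w has_derivative (\<lambda>v. correlate (\<lambda>z. E z v) w x)) (at x)" for x
    unfolding has_derivative_at_alt
  proof (intro conjI allI impI)
    have "linear (\<lambda>v. correlate (\<lambda>z. E z v) w x)"
      by (intro linearI)
        (simp_all add: correlate_def linear_add[OF linE] linear_cmul[OF linE] distrib_right mult.assoc)
    then show "bounded_linear (\<lambda>v. correlate (\<lambda>z. E z v) w x)"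
      by (simp add: linear_conv_bounded_linear)
  next
    fix e :: real assume "e > 0"
    define d where "d = e / (K * ?M + 1)"
    have KM: "0 < K * ?M + 1" using K(1) M by (simp add: add_nonneg_pos)
    have "d > 0" using \<open>e > 0\<close> KM by (simp add: d_def)
    moreover have "norm (correlate f w x' - correlate f w x - correlate (\<lambda>z. E z (x' - x)) w x)
        \<le> e * norm (x' - x)" if x': "norm (x' - x) < d" for x'
    proof -
      let ?h = "x' - x"
      have eq: "correlate f w x' - correlate f w x - correlate (\<lambda>z. E z ?h) w x
          = (\<integral>y. (f (y - x') - f (y - x) - E (y - x) ?h) * w y \<partial>lborel)"
        by (simp add: correlate_def left_diff_distrib)
      have "norm (correlate f w x' - correlate f w x - correlate (\<lambda>z. E z ?h) w x)
          \<le> (\<integral>y. norm ((f (y - x') - f (y - x) - E (y - x) ?h) * w y) \<partial>lborel)"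
        unfolding eq by (rule integral_norm_bound)
      also have "\<dots> \<le> (\<integral>y. K * (norm ?h)\<^sup>2 * \<bar>w y\<bar> \<partial>lborel)"
      proof (rule integral_mono)
        show "integrable lborel (\<lambda>y. norm ((f (y - x') - f (y - x) - E (y - x) ?h) * w y))"
          by (intro integrable_norm) (simp add: left_diff_distrib)
        show "norm ((f (y - x') - f (y - x) - E (y - x) ?h) * w y) \<le> K * (norm ?h)\<^sup>2 * \<bar>w y\<bar>" for y
          using K(2)[of "y - x" "- ?h"] linear_neg[OF linE, of "y - x" ?h]
            linear_neg[OF has_derivative_linear[OF D(1)], of "y - x" ?h]
          by (auto simp: abs_mult E_def norm_minus_commute intro!: mult_right_mono)
      qed (use w in auto)
      also have "\<dots> = (K * ?M * norm ?h) * norm ?h"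
        by (simp add: power2_eq_square)
      also have "\<dots> \<le> e * norm ?h"
      proof (rule mult_right_mono)
        have "K * ?M * norm ?h \<le> (K * ?M + 1) * d"
          using x' K(1) M by (intro mult_mono) auto
        then show "K * ?M * norm ?h \<le> e" using KM by (simp add: d_def)
      qed simp
      finally show ?thesis .
    qed
    ultimately show "\<exists>d>0. \<forall>x'. norm (x' - x) < d \<longrightarrow>
        norm (correlate f w x' - correlate f w x - correlate (\<lambda>z. E z (x' - x)) w x) \<le> e * norm (x' - x)"
      by blast
  qed
  then show ?thesis using E that[of E] by blast
qed

proposition correlate_smooth:
  fixes w :: "real ^ 'n \<Rightarrow> real"
  assumes "bump_class r f" and r: "0 \<le> r" and w: "integrable lborel w"
  shows "Ck k (correlate f w)"
  using assms(1)
proof (induction k arbitrary: f)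
  case 0
  show ?case
    using correlate_has_derivative[OF 0 r w]
    by (metis Ck.simps(1) has_derivative_continuous continuous_at_imp_continuous_on)
next
  case (Suc k)
  obtain D where D: "\<And>x. (correlate f w has_derivative (\<lambda>v. correlate (\<lambda>z. D z v) w x)) (at x)"
    "\<And>v. bump_class r (\<lambda>z. D z v)"
    using correlate_has_derivative[OF Suc.prems r w] by metis
  have "frechet_derivative (correlate f w) (at x) = (\<lambda>v. correlate (\<lambda>z. D z v) w x)" for x
    using frechet_derivative_at[OF D(1)] by simp
  moreover have "Ck k (\<lambda>x. correlate (\<lambda>z. D z v) w x)" for v
    using Suc.IH[OF D(2)] .
  ultimately show ?case
    using D(1) by (auto simp: differentiable_def)
qed

definition standard_mollifier :: "real \<Rightarrow> 'a::euclidean_space \<Rightarrow> real" where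
  "standard_mollifier r x =
     (1 / (\<integral>y. flat_exp 0 (r\<^sup>2 - y \<bullet> y) \<partial>(lborel :: 'a measure))) * flat_exp 0 (r\<^sup>2 - x \<bullet> x)"

lemma standard_mollifier_bump: "bump_class r (standard_mollifier r)"
  unfolding standard_mollifier_def[abs_def] by (intro bump_class.intros)

lemma standard_mollifier_nonneg: "0 \<le> standard_mollifier r x"
  by (auto simp: standard_mollifier_def flat_exp_nonneg)

lemma bump_class_integrable:
  fixes f :: "'a::euclidean_space \<Rightarrow> real"
  assumes f: "bump_class r f" and r: "0 \<le> r"
  shows "integrable lborel f"
proof -
  have "integrable lborel (\<lambda>x. indicator (cball 0 r) x *\<^sub>R f x)"
    by (intro borel_integrable_compact bump_class_continuous[OF f] compact_cball)
  also have "(\<lambda>x. indicator (cball 0 r) x *\<^sub>R f x) = f"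
    using bump_class_eq_0[OF f r] by (auto simp: indicator_def fun_eq_iff)
  finally show ?thesis .
qed

lemma standard_mollifier_integral:
  assumes r: "0 < r"
  shows "(\<integral>\<^sup>+x. ennreal (standard_mollifier r x) \<partial>(lborel :: 'a::euclidean_space measure)) = 1"
proof -
  let ?b = "\<lambda>x :: 'a. flat_exp 0 (r\<^sup>2 - x \<bullet> x)"
  have b: "bump_class r ?b" by (rule bump_class.flat)
  have int: "integrable lborel ?b" using bump_class_integrable[OF b] r by simp
  have "0 < (\<integral>x. ?b x \<partial>lborel)"
  proof (rule ccontr)
    assume "\<not> ?thesis"
    then have "(\<integral>x. ?b x \<partial>lborel) = 0"
      using Bochner_Integration.integral_nonneg[of lborel ?b] flat_exp_nonneg by (simp add: order_antisym)
    then have ae: "AE x in lborel. ?b x = 0"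
      using integral_nonneg_eq_0_iff_AE[OF int] flat_exp_nonneg by simp
    have pos: "x \<bullet> x < r\<^sup>2" if "x \<in> ball 0 r" for x :: 'a
      using that r by (simp add: power2_norm_eq_inner[symmetric] power_strict_mono)
    have "AE x in lborel. x \<notin> ball (0::'a) r"
      using ae
    proof eventually_elim
      case (elim x)
      then show ?case using pos[of x] by (auto simp: flat_exp_def)
    qed
    then have "emeasure lborel (ball (0::'a) r) = 0"
      by (subst (asm) AE_iff_measurable[of "ball 0 r"]) auto
    then show False using r unit_ball_vol_pos[of "real DIM('a)"] by (simp add: emeasure_ball)
  qed
  moreover have "(\<integral>\<^sup>+x. ennreal (standard_mollifier r x) \<partial>(lborel :: 'a measure))
      = ennreal (\<integral>x. standard_mollifier r x \<partial>(lborel :: 'a measure))"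
    using r by (intro nn_integral_eq_integral AE_I2 standard_mollifier_nonneg
        bump_class_integrable[OF standard_mollifier_bump]) simp
  ultimately show ?thesis by (simp add: standard_mollifier_def)
qed

section \<open>Mollification in the fractional norm\<close>

lemma correlate_shift_eq:
  fixes f w :: "'a::euclidean_space \<Rightarrow> real"
  assumes [measurable]: "f \<in> borel_measurable borel" "w \<in> borel_measurable borel"
  shows "correlate f w x = (\<integral>h. f h * w (x + h) \<partial>lborel)"
proof -
  have "correlate f w x = (\<integral>y. f (y - x) * w y \<partial>distr lborel borel ((+) x))"
    by (simp add: lborel_distr_plus correlate_def)
  also have "\<dots> = (\<integral>h. f h * w (x + h) \<partial>lborel)"
    by (subst integral_distr) auto
  finally show ?thesis .
qed

lemma ennreal_abs_integral_le:
  fixes f :: "'b \<Rightarrow> real"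
  shows "ennreal \<bar>\<integral>x. f x \<partial>M\<bar> \<le> (\<integral>\<^sup>+x. ennreal \<bar>f x\<bar> \<partial>M)"
  using integral_norm_bound_ennreal[of M f]
  by (cases "integrable M f") (auto simp: not_integrable_integral_eq)

text \<open>Minkowski's integral inequality.\<close>

lemma L1norm_average_le:
  fixes \<rho> :: "'a::euclidean_space \<Rightarrow> real" and G :: "'a \<Rightarrow> 'a \<Rightarrow> real"
  assumes [measurable]: "\<rho> \<in> borel_measurable borel" "case_prod G \<in> borel_measurable borel"
    and \<rho>: "\<And>h. 0 \<le> \<rho> h"
  shows "L1norm (\<lambda>x. \<integral>h. \<rho> h * G h x \<partial>lborel) \<le> (\<integral>\<^sup>+h. ennreal (\<rho> h) * L1norm (G h) \<partial>lborel)"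
proof -
  have [measurable]: "case_prod G \<in> borel_measurable (borel \<Otimes>\<^sub>M borel)"
    by (simp add: borel_prod)
  have "L1norm (\<lambda>x. \<integral>h. \<rho> h * G h x \<partial>lborel)
      \<le> (\<integral>\<^sup>+x. \<integral>\<^sup>+h. ennreal \<bar>\<rho> h * G h x\<bar> \<partial>lborel \<partial>lborel)"
    unfolding L1norm_def by (intro nn_integral_mono ennreal_abs_integral_le)
  also have "\<dots> = (\<integral>\<^sup>+h. \<integral>\<^sup>+x. ennreal \<bar>\<rho> h * G h x\<bar> \<partial>lborel \<partial>lborel)"
    by (rule lborel_pair.Fubini') measurable
  also have "\<dots> = (\<integral>\<^sup>+h. ennreal (\<rho> h) * L1norm (G h) \<partial>lborel)"
    unfolding L1norm_def
    by (intro nn_integral_cong, subst nn_integral_cmult[symmetric])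
      (auto simp: abs_mult \<rho> ennreal_mult)
  finally show ?thesis .
qed

lemma frac_norm_minus_commute:
  "frac_norm s (\<lambda>x. u x - v x) = frac_norm s (\<lambda>x. v x - u x)"
proof -
  have "L1norm (\<lambda>x. (u (x + z) - v (x + z)) - (u x - v x))
      = L1norm (\<lambda>x. (v (x + z) - u (x + z)) - (v x - u x))" for z
    unfolding L1norm_def by (intro nn_integral_cong arg_cong[where f = ennreal]) linarith
  then show ?thesis
    by (simp add: frac_norm_def frac_seminorm_def L1norm_minus_commute[of u v])
qed

lemma frac_norm_perturb_finite:
  fixes u v :: "'a::euclidean_space \<Rightarrow> real"
  assumes "u \<in> borel_measurable borel" "v \<in> borel_measurable borel"
    and "frac_norm s u < \<infinity>" "frac_norm s (\<lambda>x. v x - u x) < \<infinity>"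
  shows "frac_norm s v < \<infinity>"
proof -
  have "frac_norm s v \<le> frac_norm s u + frac_norm s (\<lambda>x. v x - u x)"
    using frac_norm_add_le[of u "\<lambda>x. v x - u x" s] assms(1,2) by simp
  also have "\<dots> < \<infinity>" using assms(3,4) by simp
  finally show ?thesis .
qed

text \<open>The mollified function is an average of translates of \<open>u\<close> by vectors shorter than \<open>r k\<close>. By
  Minkowski's inequality it inherits convergence in the mean from continuity of translations, and its
  increments, being averages of translates of the increments of \<open>u\<close>, are no larger than those of \<open>u\<close>.\<close>

proposition frac_norm_mollification:
  fixes u :: "'a::euclidean_space \<Rightarrow> real"
  assumes [measurable]: "u \<in> borel_measurable borel" and fin: "frac_norm s u < \<infinity>"
    and r: "\<And>k. 0 < r k" "r \<longlonglongrightarrow> 0"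
  shows "(\<lambda>k. frac_norm s (\<lambda>x. correlate (standard_mollifier (r k)) u x - u x)) \<longlonglongrightarrow> 0"
proof (rule frac_norm_convergence[OF _ _ fin])
  have int: "integrable lborel u"
    using fin by (subst L1norm_finite_iff_integrable[symmetric]) (auto simp: frac_norm_def)
  let ?\<rho> = "\<lambda>k. standard_mollifier (r k) :: 'a \<Rightarrow> real"
  have bump: "bump_class (r k) (?\<rho> k)" for k by (rule standard_mollifier_bump)
  have r0: "0 \<le> r k" for k using r(1)[of k] by simp
  have [measurable]: "?\<rho> k \<in> borel_measurable borel" for k
    using bump_class_continuous[OF bump] by (rule borel_measurable_continuous_onI)
  show [measurable]: "correlate (?\<rho> k) u \<in> borel_measurable borel" for k
    unfolding correlate_def[abs_def] by measurable
  have intk: "integrable lborel (\<lambda>h. ?\<rho> k h * u (x + h))" for k x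
  proof -
    have "integrable (distr lborel borel ((+) x)) (\<lambda>y. ?\<rho> k (y - x) * u y)"
      using integrable_bump_mult[OF bump r0 int, of k x] by (simp add: lborel_distr_plus)
    then show ?thesis by (subst (asm) integrable_distr_eq) auto
  qed
  have int\<rho>: "integrable lborel (?\<rho> k)" for k by (rule bump_class_integrable[OF bump r0])
  have one: "(\<integral>\<^sup>+h. ennreal (?\<rho> k h) \<partial>lborel) = 1" for k by (rule standard_mollifier_integral[OF r(1)])
  have one': "(\<integral>h. ?\<rho> k h \<partial>lborel) = 1" for k
  proof -
    have "ennreal (\<integral>h. ?\<rho> k h \<partial>lborel) = (\<integral>\<^sup>+h. ennreal (?\<rho> k h) \<partial>lborel)"
      by (intro nn_integral_eq_integral[symmetric] int\<rho> AE_I2 standard_mollifier_nonneg)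
    then show ?thesis unfolding one by simp
  qed
  note eq = correlate_shift_eq[OF \<open>?\<rho> _ \<in> borel_measurable borel\<close> assms(1)]
  show "L1norm (\<lambda>x. correlate (?\<rho> k) u (x + z) - correlate (?\<rho> k) u x) \<le> L1norm (\<lambda>x. u (x + z) - u x)" for k z
  proof -
    have "correlate (?\<rho> k) u (x + z) - correlate (?\<rho> k) u x
        = (\<integral>h. ?\<rho> k h * (u (x + h + z) - u (x + h)) \<partial>lborel)" for x
    proof -
      have shift: "x + z + h = x + h + z" for h by (simp add: add_ac)
      show ?thesis
        using intk[of k "x + z"] intk[of k x]
        unfolding eq right_diff_distrib shift by (rule Bochner_Integration.integral_diff[symmetric])
    qed
    then have "L1norm (\<lambda>x. correlate (?\<rho> k) u (x + z) - correlate (?\<rho> k) u x)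
        = L1norm (\<lambda>x. \<integral>h. ?\<rho> k h * (u (x + h + z) - u (x + h)) \<partial>lborel)"
      by simp
    also have "\<dots> \<le> (\<integral>\<^sup>+h. ennreal (?\<rho> k h) * L1norm (\<lambda>x. u (x + h + z) - u (x + h)) \<partial>lborel)"
      by (rule L1norm_average_le) (auto simp: standard_mollifier_nonneg borel_prod[symmetric])
    also have "\<dots> = (\<integral>\<^sup>+h. ennreal (?\<rho> k h) * L1norm (\<lambda>x. u (x + z) - u x) \<partial>lborel)"
      using L1norm_shift[of "\<lambda>x. u (x + z) - u x"] by simp
    also have "\<dots> = L1norm (\<lambda>x. u (x + z) - u x)"
      by (simp add: nn_integral_multc one)
    finally show ?thesis .
  qed
  show "(\<lambda>k. L1norm (\<lambda>x. correlate (?\<rho> k) u x - u x)) \<longlonglongrightarrow> 0"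
  proof (rule order_tendstoI)
    fix a :: ennreal assume "0 < a"
    then obtain e where e: "0 < e" "e < a" using dense by blast
    have "eventually (\<lambda>h. L1norm (\<lambda>x. u (x + h) - u x) < e) (at 0)"
      using L1_translation_continuous[OF int] e by (intro order_tendstoD) auto
    then obtain d where d: "0 < d" "\<And>h. h \<noteq> 0 \<Longrightarrow> norm h < d \<Longrightarrow> L1norm (\<lambda>x. u (x + h) - u x) < e"
      by (auto simp: eventually_at)
    have small: "L1norm (\<lambda>x. u (x + h) - u x) \<le> e" if "norm h < d" for h
      using d(2)[of h] that by (cases "h = 0") (auto simp: L1norm_def less_imp_le)
    have "eventually (\<lambda>k. r k < d) sequentially"
      using r(2) d(1) by (intro order_tendstoD) auto
    then show "eventually (\<lambda>k. L1norm (\<lambda>x. correlate (?\<rho> k) u x - u x) < a) sequentially"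
    proof eventually_elim
      case (elim k)
      have "L1norm (\<lambda>x. correlate (?\<rho> k) u x - u x)
          = L1norm (\<lambda>x. \<integral>h. ?\<rho> k h * (u (x + h) - u x) \<partial>lborel)"
        unfolding eq using intk[of k] int\<rho>[of k] one'[of k] by (simp add: right_diff_distrib)
      also have "\<dots> \<le> (\<integral>\<^sup>+h. ennreal (?\<rho> k h) * L1norm (\<lambda>x. u (x + h) - u x) \<partial>lborel)"
        by (rule L1norm_average_le) (auto simp: standard_mollifier_nonneg borel_prod[symmetric])
      also have "\<dots> \<le> (\<integral>\<^sup>+h. ennreal (?\<rho> k h) * e \<partial>lborel)"
      proof (rule nn_integral_mono)
        fix h
        show "ennreal (?\<rho> k h) * L1norm (\<lambda>x. u (x + h) - u x) \<le> ennreal (?\<rho> k h) * e"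
          using bump_class_eq_0[OF bump r0, of k h] small[of h] elim
          by (cases "norm h < r k") (auto intro!: mult_left_mono)
      qed
      also have "\<dots> = e" by (simp add: nn_integral_multc one)
      also have "\<dots> < a" by (rule e)
      finally show ?case .
    qed
  qed auto
qed auto

section \<open>Density of test functions in a Lipschitz domain\<close>

definition test_approximable :: "real \<Rightarrow> (real ^ 'n) set \<Rightarrow> (real ^ 'n \<Rightarrow> real) \<Rightarrow> bool" where
  "test_approximable s \<Omega> u \<longleftrightarrow> (\<forall>e>0. \<exists>\<phi>\<in>test_functions \<Omega>. frac_norm s (\<lambda>x. u x - \<phi> x) < e)"

lemma test_function_borel:
  assumes "\<phi> \<in> test_functions \<Omega>" shows "\<phi> \<in> borel_measurable borel"
proof -
  have "Ck 0 \<phi>" using assms unfolding test_functions_def by blast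
  then show ?thesis by (simp add: borel_measurable_continuous_onI)
qed

lemma Ck_add: "Ck k u \<Longrightarrow> Ck k v \<Longrightarrow> Ck k (\<lambda>x. u x + v x)"
proof (induction k arbitrary: u v)
  case 0
  then show ?case by (simp add: continuous_on_add)
next
  case (Suc k)
  then have d: "u differentiable at x" "v differentiable at x" for x by auto
  have "frechet_derivative (\<lambda>x. u x + v x) (at x)
      = (\<lambda>h. frechet_derivative u (at x) h + frechet_derivative v (at x) h)" for x
    using d[of x, THEN frechet_derivative_works[THEN iffD1]]
    by (intro frechet_derivative_at[symmetric] has_derivative_add)
  then show ?case using Suc d by auto
qed

lemma Ck_zero: "Ck k (\<lambda>x. 0)"
  by (induction k) auto

lemma compact_closure_subset:
  fixes A C :: "'a::heine_borel set"
  assumes "closure A \<subseteq> C" "compact C"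
  shows "compact (closure A)"
  using assms by (metis bounded_subset closure_subset compact_closure compact_imp_bounded)

lemma test_functions_add:
  assumes u: "u \<in> test_functions \<Omega>" and v: "v \<in> test_functions \<Omega>"
  shows "(\<lambda>x. u x + v x) \<in> test_functions \<Omega>"
proof -
  have sub: "closure {x. u x + v x \<noteq> 0} \<subseteq> closure {x. u x \<noteq> 0} \<union> closure {x. v x \<noteq> 0}"
    unfolding closure_Un[symmetric] by (rule closure_mono) auto
  moreover have "compact (closure {x. u x \<noteq> 0} \<union> closure {x. v x \<noteq> 0})"
    using u v by (auto simp: test_functions_def)
  ultimately have "compact (closure {x. u x + v x \<noteq> 0})"
    by (rule compact_closure_subset)
  moreover have "Ck k (\<lambda>x. u x + v x)" for k
  proof (rule Ck_add)
    show "Ck k u" "Ck k v" using u v unfolding test_functions_def by simp_all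
  qed
  moreover have "closure {x. u x \<noteq> 0} \<subseteq> \<Omega>" "closure {x. v x \<noteq> 0} \<subseteq> \<Omega>"
    using u v unfolding test_functions_def by simp_all
  then have "closure {x. u x + v x \<noteq> 0} \<subseteq> \<Omega>" using sub by (meson Un_least order_trans)
  ultimately show ?thesis unfolding test_functions_def by simp
qed

lemma zero_test_function: "(\<lambda>x. 0) \<in> test_functions \<Omega>"
  by (simp add: test_functions_def Ck_zero)

lemma frac_norm_zero: "frac_norm s (\<lambda>x. 0) = 0"
  by (simp add: frac_norm_def frac_seminorm_def L1norm_def)

lemma test_approximable_zero: "test_approximable s \<Omega> (\<lambda>x. 0)"
  using zero_test_function by (force simp: test_approximable_def frac_norm_zero)

lemma ennreal_halves:
  fixes e :: ennreal
  assumes "0 < e"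
  obtains d where "0 < d" "\<And>a b. a < d \<Longrightarrow> b < d \<Longrightarrow> a + b < e"
proof
  let ?d = "min (e / 2) 1"
  show "0 < ?d" using assms by (simp add: ennreal_zero_less_divide)
  show "a + b < e" if "a < ?d" "b < ?d" for a b
  proof -
    have "a + b < e / 2 + e / 2" using that by (intro add_strict_mono) auto
    then show ?thesis by (simp add: ennreal_times_divide ennreal_mult_divide_eq mult.commute[of 2] flip: mult_2)
  qed
qed

lemma test_approximable_add:
  assumes [measurable]: "u \<in> borel_measurable borel" "v \<in> borel_measurable borel"
    and u: "test_approximable s \<Omega> u" and v: "test_approximable s \<Omega> v"
  shows "test_approximable s \<Omega> (\<lambda>x. u x + v x)"
  unfolding test_approximable_def
proof (intro allI impI)
  fix e :: ennreal assume "0 < e"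
  then obtain d where d: "0 < d" "\<And>a b. a < d \<Longrightarrow> b < d \<Longrightarrow> a + b < e"
    using ennreal_halves by blast
  obtain \<phi> where \<phi>: "\<phi> \<in> test_functions \<Omega>" "frac_norm s (\<lambda>x. u x - \<phi> x) < d"
    using u d(1) unfolding test_approximable_def by blast
  obtain \<psi> where \<psi>: "\<psi> \<in> test_functions \<Omega>" "frac_norm s (\<lambda>x. v x - \<psi> x) < d"
    using v d(1) unfolding test_approximable_def by blast
  have [measurable]: "\<phi> \<in> borel_measurable borel" "\<psi> \<in> borel_measurable borel"
    using \<phi> \<psi> test_function_borel by auto
  have "frac_norm s (\<lambda>x. (u x + v x) - (\<phi> x + \<psi> x)) = frac_norm s (\<lambda>x. (u x - \<phi> x) + (v x - \<psi> x))"
    by (simp add: algebra_simps)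
  also have "\<dots> \<le> frac_norm s (\<lambda>x. u x - \<phi> x) + frac_norm s (\<lambda>x. v x - \<psi> x)"
    by (rule frac_norm_add_le) measurable
  also have "\<dots> < e" using d(2) \<phi>(2) \<psi>(2) by blast
  finally show "\<exists>\<phi>\<in>test_functions \<Omega>. frac_norm s (\<lambda>x. u x + v x - \<phi> x) < e"
    using test_functions_add[OF \<phi>(1) \<psi>(1)] by (intro bexI[of _ "\<lambda>x. \<phi> x + \<psi> x"])
qed

lemma test_approximable_closed:
  assumes [measurable]: "u \<in> borel_measurable borel" "\<And>k. v k \<in> borel_measurable borel"
    and v: "\<And>k. test_approximable s \<Omega> (v k)"
    and conv: "(\<lambda>k. frac_norm s (\<lambda>x. v k x - u x)) \<longlonglongrightarrow> 0"
  shows "test_approximable s \<Omega> u"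
  unfolding test_approximable_def
proof (intro allI impI)
  fix e :: ennreal assume "0 < e"
  then obtain d where d: "0 < d" "\<And>a b. a < d \<Longrightarrow> b < d \<Longrightarrow> a + b < e"
    using ennreal_halves by blast
  have "eventually (\<lambda>k. frac_norm s (\<lambda>x. v k x - u x) < d) sequentially"
    using conv d(1) by (rule order_tendstoD)
  then obtain k where k: "frac_norm s (\<lambda>x. u x - v k x) < d"
    by (auto simp: eventually_sequentially frac_norm_minus_commute[of s u])
  obtain \<phi> where \<phi>: "\<phi> \<in> test_functions \<Omega>" "frac_norm s (\<lambda>x. v k x - \<phi> x) < d"
    using v d(1) unfolding test_approximable_def by blast
  have [measurable]: "\<phi> \<in> borel_measurable borel"
    using \<phi> test_function_borel by auto
  have "frac_norm s (\<lambda>x. u x - \<phi> x) \<le> frac_norm s (\<lambda>x. u x - v k x) + frac_norm s (\<lambda>x. v k x - \<phi> x)"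
    using frac_norm_add_le[of "\<lambda>x. u x - v k x" "\<lambda>x. v k x - \<phi> x" s] by simp
  also have "\<dots> < e" using d(2) \<phi>(2) k by blast
  finally show "\<exists>\<phi>\<in>test_functions \<Omega>. frac_norm s (\<lambda>x. u x - \<phi> x) < e"
    using \<phi>(1) by blast
qed

text \<open>Mollification at a scale below the distance from \<open>K\<close> to the complement of \<open>\<Omega>\<close> yields test
  functions.\<close>

proposition test_approximable_compact_support:
  fixes u :: "real ^ 'n \<Rightarrow> real"
  assumes [measurable]: "u \<in> borel_measurable borel" and fin: "frac_norm s u < \<infinity>"
    and \<Omega>: "open \<Omega>" and K: "compact K" "K \<subseteq> \<Omega>" and supp: "\<And>x. x \<notin> K \<Longrightarrow> u x = 0"
  shows "test_approximable s \<Omega> u"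
proof -
  obtain d where d: "0 < d" "(\<Union>x\<in>K. cball x d) \<subseteq> \<Omega>"
    using compact_subset_open_imp_cball_epsilon_subset[OF K(1) \<Omega> K(2)] .
  define r where "r k = d / real (Suc k)" for k
  have r: "0 < r k" "r k \<le> d" for k using d(1) by (auto simp: r_def field_simps)
  have r0: "0 \<le> r k" for k using r(1)[of k] by simp
  have rlim: "r \<longlonglongrightarrow> 0"
    unfolding r_def using tendsto_mult[OF tendsto_const LIMSEQ_inverse_real_of_nat, of d]
    by (simp add: divide_inverse)
  have int: "integrable lborel u"
    using fin by (subst L1norm_finite_iff_integrable[symmetric]) (auto simp: frac_norm_def)
  let ?\<phi> = "\<lambda>k. correlate (standard_mollifier (r k)) u"
  have test: "?\<phi> k \<in> test_functions \<Omega>" for k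
  proof -
    define C where "C = (\<Union>x\<in>K. \<Union>y\<in>cball 0 d. {x + y})"
    have "compact C" unfolding C_def by (rule compact_sums'[OF K(1) compact_cball])
    have "C \<subseteq> \<Omega>"
    proof
      fix z assume "z \<in> C"
      then obtain x y where "x \<in> K" "norm y \<le> d" "z = x + y" by (auto simp: C_def)
      then have "z \<in> cball x d" by (simp add: dist_norm)
      then show "z \<in> \<Omega>" using d(2) \<open>x \<in> K\<close> by blast
    qed
    have "{x. ?\<phi> k x \<noteq> 0} \<subseteq> C"
    proof
      fix x assume "x \<in> {x. ?\<phi> k x \<noteq> 0}"
      then obtain y where y: "standard_mollifier (r k) (y - x) * u y \<noteq> 0"
        unfolding correlate_def by (metis (mono_tags, lifting) Bochner_Integration.integral_cong integral_zero mem_Collect_eq)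
      then have "y \<in> K" using supp by force
      moreover have "norm (y - x) < r k"
        using y bump_class_eq_0[OF standard_mollifier_bump r0, of k "y - x"] by force
      then have "x - y \<in> cball 0 d" using r(2)[of k] by (simp add: norm_minus_commute)
      ultimately show "x \<in> C" unfolding C_def by (force intro: bexI[of _ y] bexI[of _ "x - y"])
    qed
    then have sub: "closure {x. ?\<phi> k x \<noteq> 0} \<subseteq> C"
      using \<open>compact C\<close> by (simp add: closure_minimal compact_imp_closed)
    then have "compact (closure {x. ?\<phi> k x \<noteq> 0})"
      using \<open>compact C\<close> by (rule compact_closure_subset)
    then show ?thesis
      using sub \<open>C \<subseteq> \<Omega>\<close> correlate_smooth[OF standard_mollifier_bump r0 int]
      by (auto simp: test_functions_def)
  qed
  show ?thesis
  proof (rule test_approximable_closed)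
    show "(\<lambda>k. frac_norm s (\<lambda>x. ?\<phi> k x - u x)) \<longlonglongrightarrow> 0"
      by (rule frac_norm_mollification[OF _ fin r(1) rlim]) measurable
    show "?\<phi> k \<in> borel_measurable borel" for k by (rule test_function_borel[OF test])
    show "test_approximable s \<Omega> (?\<phi> k)" for k
      unfolding test_approximable_def using test[of k] by (auto intro!: bexI[of _ "?\<phi> k"] simp: frac_norm_zero)
  qed measurable
qed

text \<open>Where \<open>\<Omega>\<close> is the region strictly above a graph, \<open>u\<close> lives in the closed region above it. Moving \<open>u\<close>
  upwards by any small positive amount puts its support into a compact subset of \<open>\<Omega>\<close>, and a small move
  changes \<open>u\<close> little in the fractional norm.\<close>

proposition test_approximable_near_boundary:
  fixes u :: "real ^ 'n \<Rightarrow> real"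
  assumes [measurable]: "u \<in> borel_measurable borel" and fin: "frac_norm s u < \<infinity>"
    and \<Omega>: "open \<Omega>" and supp: "\<And>x. x \<notin> \<Omega> \<Longrightarrow> u x = 0" "\<And>x. x \<notin> cball p \<rho> \<Longrightarrow> u x = 0"
    and \<nu>: "norm \<nu> = 1" and g: "continuous_on {z. z \<bullet> \<nu> = 0} g" and "\<rho> < r"
    and graph: "\<Omega> \<inter> ball p r = {y \<in> ball p r. g (y - (y \<bullet> \<nu>) *\<^sub>R \<nu>) < y \<bullet> \<nu>}"
  shows "test_approximable s \<Omega> u"
proof -
  let ?g = "\<lambda>y. g (y - (y \<bullet> \<nu>) *\<^sub>R \<nu>)"
  have \<nu>\<nu>: "\<nu> \<bullet> \<nu> = 1" using \<nu> by (simp add: norm_eq_1)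
  have cont: "continuous_on UNIV ?g"
    by (rule continuous_on_compose2[OF g]) (auto intro!: continuous_intros simp: inner_diff_left \<nu>\<nu>)
  define K where "K = cball p \<rho> \<inter> {y. ?g y \<le> y \<bullet> \<nu>}"
  have "closed {y. ?g y \<le> y \<bullet> \<nu>}"
    by (intro closed_Collect_le cont continuous_intros)
  then have K: "compact K" unfolding K_def by (intro compact_Int_closed compact_cball)
  have zero: "u x = 0" if "x \<notin> K" for x
  proof (rule ccontr)
    assume "u x \<noteq> 0"
    then have "x \<in> \<Omega>" "x \<in> cball p \<rho>" using supp by auto
    then have "x \<in> \<Omega> \<inter> ball p r" using \<open>\<rho> < r\<close> by auto
    then have "?g x < x \<bullet> \<nu>" unfolding graph by simp
    with \<open>x \<in> cball p \<rho>\<close> that show False by (simp add: K_def)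
  qed
  define t where "t k = (r - \<rho>) / real (k + 2)" for k
  have t: "0 < t k" "t k < r - \<rho>" for k using \<open>\<rho> < r\<close> by (auto simp: t_def divide_less_eq)
  have "t \<longlonglongrightarrow> 0"
    using LIMSEQ_ignore_initial_segment[OF tendsto_mult[OF tendsto_const LIMSEQ_inverse_real_of_nat, of "r - \<rho>"], of 1]
    by (simp add: t_def[abs_def] divide_inverse add_ac)
  then have lim: "(\<lambda>k. - (t k *\<^sub>R \<nu>)) \<longlonglongrightarrow> 0"
    by (auto intro!: tendsto_eq_intros)
  let ?v = "\<lambda>k x. u (x + - (t k *\<^sub>R \<nu>))"
  have conv: "(\<lambda>k. frac_norm s (\<lambda>x. ?v k x - u x)) \<longlonglongrightarrow> 0"
    by (rule frac_norm_translation_continuous[OF _ fin lim]) measurable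
  have "eventually (\<lambda>k. frac_norm s (\<lambda>x. ?v k x - u x) < \<infinity>) sequentially"
    using conv by (rule order_tendstoD) simp
  then obtain N where N: "\<And>k. N \<le> k \<Longrightarrow> frac_norm s (\<lambda>x. ?v k x - u x) < \<infinity>"
    by (auto simp: eventually_sequentially)
  \<comment> \<open>The shift by \<open>N\<close> keeps only translates already known to have finite norm.\<close>
  show ?thesis
  proof (rule test_approximable_closed)
    show "(\<lambda>k. frac_norm s (\<lambda>x. ?v (k + N) x - u x)) \<longlonglongrightarrow> 0"
      using LIMSEQ_ignore_initial_segment[OF conv] .
    show "test_approximable s \<Omega> (?v (k + N))" for k
    proof (rule test_approximable_compact_support[OF _ _ \<Omega>])
      let ?T = "(+) (t (k + N) *\<^sub>R \<nu>)"
      show "frac_norm s (?v (k + N)) < \<infinity>"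
        by (rule frac_norm_perturb_finite[of u, OF _ _ fin]) (use N in auto)
      show "compact (?T ` K)" using K by (rule compact_translation)
      show "?T ` K \<subseteq> \<Omega>"
      proof
        fix x assume "x \<in> ?T ` K"
        then obtain y where y: "x = t (k + N) *\<^sub>R \<nu> + y" "y \<in> K" by auto
        have "dist p x \<le> dist p y + t (k + N)"
          using dist_triangle[of p x y] t(1)[of "k + N"] \<nu> by (simp add: y dist_norm)
        also have "\<dots> < r" using y(2) t(2)[of "k + N"] by (simp add: K_def)
        finally have "x \<in> ball p r" by simp
        moreover have x\<nu>: "x \<bullet> \<nu> = t (k + N) + y \<bullet> \<nu>"
          by (simp add: y(1) inner_add_left \<nu>\<nu>)
        have "x - (x \<bullet> \<nu>) *\<^sub>R \<nu> = y - (y \<bullet> \<nu>) *\<^sub>R \<nu>"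
          unfolding x\<nu> by (simp add: y(1) scaleR_add_left)
        then have "?g x = ?g y" by (rule arg_cong)
        with x\<nu> have "?g x < x \<bullet> \<nu>"
          using y(2) t(1)[of "k + N"] by (simp add: K_def)
        ultimately have "x \<in> \<Omega> \<inter> ball p r" unfolding graph by simp
        then show "x \<in> \<Omega>" by simp
      qed
      show "?v (k + N) x = 0" if "x \<notin> ?T ` K" for x
      proof (rule zero, rule notI)
        assume "x + - (t (k + N) *\<^sub>R \<nu>) \<in> K"
        then have "?T (x + - (t (k + N) *\<^sub>R \<nu>)) \<in> ?T ` K" by (rule imageI)
        with that show False by simp
      qed
    qed measurable
  qed measurable
qed

definition cutoff :: "'a::metric_space \<Rightarrow> real \<Rightarrow> 'a \<Rightarrow> real" where
  "cutoff p \<rho> x = max 0 (min 1 (2 - dist p x / \<rho>))"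

lemma cutoff_Lipschitz: "0 < \<rho> \<Longrightarrow> (1 / \<rho>)-lipschitz_on UNIV (cutoff p \<rho>)"
proof (rule lipschitz_onI)
  fix x y assume "0 < \<rho>"
  have "dist (cutoff p \<rho> x) (cutoff p \<rho> y) \<le> \<bar>dist p x / \<rho> - dist p y / \<rho>\<bar>"
    unfolding cutoff_def dist_real_def by linarith
  also have "\<dots> = \<bar>dist p x - dist p y\<bar> / \<rho>"
    using \<open>0 < \<rho>\<close> by (simp add: diff_divide_distrib[symmetric])
  also have "\<dots> \<le> dist x y / \<rho>"
    using \<open>0 < \<rho>\<close> abs_dist_diff_le[of x p y] by (intro divide_right_mono) (auto simp: dist_commute)
  finally show "dist (cutoff p \<rho> x) (cutoff p \<rho> y) \<le> 1 / \<rho> * dist x y" by simp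
qed auto

lemma cutoff_le_one: "\<bar>cutoff p \<rho> x\<bar> \<le> 1" "\<bar>1 - cutoff p \<rho> x\<bar> \<le> 1"
  by (auto simp: cutoff_def)

lemma cutoff_eq: "0 < \<rho> \<Longrightarrow> x \<in> ball p \<rho> \<Longrightarrow> cutoff p \<rho> x = 1"
  "0 < \<rho> \<Longrightarrow> x \<notin> cball p (2 * \<rho>) \<Longrightarrow> cutoff p \<rho> x = 0"
  by (auto simp: cutoff_def field_simps min_def max_def)

text \<open>The radius is doubled because the cutoff that equals one on the ball of radius \<open>\<rho>\<close> vanishes only outside
  the ball of radius \<open>2 * \<rho>\<close>.\<close>

definition local_density :: "real \<Rightarrow> (real ^ 'n) set \<Rightarrow> real ^ 'n \<Rightarrow> real \<Rightarrow> bool" where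
  "local_density s \<Omega> p \<rho> \<longleftrightarrow> (\<forall>u. u \<in> borel_measurable borel \<longrightarrow> frac_norm s u < \<infinity> \<longrightarrow>
     (\<forall>x. x \<notin> \<Omega> \<longrightarrow> u x = 0) \<longrightarrow> (\<forall>x. x \<notin> cball p (2 * \<rho>) \<longrightarrow> u x = 0) \<longrightarrow> test_approximable s \<Omega> u)"

lemma local_density_closure:
  fixes \<Omega> :: "(real ^ 'n) set"
  assumes \<Omega>: "open \<Omega>" "lipschitz_boundary \<Omega>" and p: "p \<in> closure \<Omega>"
  shows "\<exists>\<rho>>0. local_density s \<Omega> p \<rho>"
proof (cases "p \<in> \<Omega>")
  case True
  then obtain r where r: "0 < r" "cball p r \<subseteq> \<Omega>"
    using \<Omega>(1) open_contains_cball by blast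
  have "local_density s \<Omega> p (r / 2)"
    unfolding local_density_def
    using test_approximable_compact_support[OF _ _ \<Omega>(1) compact_cball r(2)] by auto
  then show ?thesis using r(1) by (intro exI[of _ "r / 2"]) auto
next
  case False
  then have "p \<in> frontier \<Omega>" using p \<Omega>(1) by (simp add: frontier_def interior_open)
  then obtain r \<nu> L g where r: "0 < r" and \<nu>: "norm \<nu> = 1"
    and g: "L-lipschitz_on {z. z \<bullet> \<nu> = 0} (g :: real ^ 'n \<Rightarrow> real)"
    and graph: "\<Omega> \<inter> ball p r = {y \<in> ball p r. g (y - (y \<bullet> \<nu>) *\<^sub>R \<nu>) < y \<bullet> \<nu>}"
    using \<Omega>(2) unfolding lipschitz_boundary_def by blast
  have "local_density s \<Omega> p (r / 4)"
    unfolding local_density_def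
  proof (intro allI impI)
    fix u :: "real ^ 'n \<Rightarrow> real"
    assume u: "u \<in> borel_measurable borel" "frac_norm s u < \<infinity>"
      "\<forall>x. x \<notin> \<Omega> \<longrightarrow> u x = 0" "\<forall>x. x \<notin> cball p (2 * (r / 4)) \<longrightarrow> u x = 0"
    show "test_approximable s \<Omega> u"
      by (rule test_approximable_near_boundary[OF u(1,2) \<Omega>(1) _ _ \<nu> lipschitz_on_continuous_on[OF g] _ graph,
            where \<rho> = "2 * (r / 4)"]) (use u r in auto)
  qed
  then show ?thesis using r by (intro exI[of _ "r / 4"]) auto
qed

text \<open>Splitting off \<open>\<eta> * u\<close> for a cutoff \<open>\<eta>\<close> of one ball leaves \<open>(1 - \<eta>) * u\<close>, which vanishes on that ball,
  so that the remaining balls cover it. This replaces a partition of unity.\<close>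

lemma test_approximable_covered:
  fixes \<Omega> :: "(real ^ 'n) set"
  assumes s: "0 < s" "s < 1" and "finite J"
    and J: "\<And>p. p \<in> J \<Longrightarrow> 0 < \<rho> p" "\<And>p. p \<in> J \<Longrightarrow> local_density s \<Omega> p (\<rho> p)"
    and u: "u \<in> borel_measurable borel" "frac_norm s u < \<infinity>" "\<And>x. x \<notin> \<Omega> \<Longrightarrow> u x = 0"
      "\<And>x. x \<notin> (\<Union>p\<in>J. ball p (\<rho> p)) \<Longrightarrow> u x = 0"
  shows "test_approximable s \<Omega> u"
  using assms(3-)
proof (induction J arbitrary: u rule: finite_induct)
  case empty
  then have "u = (\<lambda>x. 0)" by auto
  then show ?case by (simp add: test_approximable_zero)
next
  case (insert p J)
  let ?\<eta> = "cutoff p (\<rho> p)"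
  have \<rho>: "0 < \<rho> p" using insert.prems(1) by simp
  note L = cutoff_Lipschitz[OF \<rho>, of p]
  have L': "(1 / \<rho> p)-lipschitz_on UNIV (\<lambda>x. 1 - ?\<eta> x)"
    using lipschitz_onD[OF L] lipschitz_on_nonneg[OF L]
    by (intro lipschitz_onI) (auto simp: dist_real_def abs_minus_commute)
  have [measurable]: "?\<eta> \<in> borel_measurable borel" "u \<in> borel_measurable borel"
    using lipschitz_on_continuous_on[OF L] insert.prems(3) by (auto intro: borel_measurable_continuous_onI)
  have "test_approximable s \<Omega> (\<lambda>x. ?\<eta> x * u x)"
  proof -
    have "frac_norm s (\<lambda>x. ?\<eta> x * u x) < \<infinity>"
      using frac_norm_cutoff_finite[OF s _ _ L cutoff_le_one(1)] insert.prems(3,4) by blast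
    moreover have "(\<lambda>x. ?\<eta> x * u x) \<in> borel_measurable borel" by measurable
    moreover have "\<forall>x. x \<notin> \<Omega> \<longrightarrow> ?\<eta> x * u x = 0" "\<forall>x. x \<notin> cball p (2 * \<rho> p) \<longrightarrow> ?\<eta> x * u x = 0"
      using insert.prems(5) cutoff_eq(2)[OF \<rho>, of _ p] by auto
    moreover have "local_density s \<Omega> p (\<rho> p)" using insert.prems(2) by simp
    ultimately show ?thesis unfolding local_density_def by blast
  qed
  moreover have "test_approximable s \<Omega> (\<lambda>x. (1 - ?\<eta> x) * u x)"
  proof (rule insert.IH)
    show "frac_norm s (\<lambda>x. (1 - ?\<eta> x) * u x) < \<infinity>"
      using frac_norm_cutoff_finite[OF s _ _ L' cutoff_le_one(2)] insert.prems(3,4) by blast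
    show "(1 - ?\<eta> x) * u x = 0" if "x \<notin> (\<Union>p\<in>J. ball p (\<rho> p))" for x
      using cutoff_eq(1)[OF \<rho>, of x p] insert.prems(6)[of x] that by auto
  qed (use insert.prems in auto)
  ultimately have "test_approximable s \<Omega> (\<lambda>x. ?\<eta> x * u x + (1 - ?\<eta> x) * u x)"
    by (intro test_approximable_add) measurable
  then show ?case by (simp add: algebra_simps)
qed

theorem test_approximable_Lipschitz_domain:
  fixes u :: "real ^ 'n \<Rightarrow> real"
  assumes s: "0 < s" "s < 1" and \<Omega>: "open \<Omega>" "bounded \<Omega>" "lipschitz_boundary \<Omega>"
    and u: "u \<in> borel_measurable borel" "frac_norm s u < \<infinity>" "\<And>x. x \<notin> \<Omega> \<Longrightarrow> u x = 0"
  shows "test_approximable s \<Omega> u"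
proof -
  have "\<forall>p\<in>closure \<Omega>. \<exists>\<rho>>0. local_density s \<Omega> p \<rho>"
    using local_density_closure[OF \<Omega>(1,3)] by blast
  then obtain \<rho> where \<rho>: "\<And>p. p \<in> closure \<Omega> \<Longrightarrow> 0 < \<rho> p \<and> local_density s \<Omega> p (\<rho> p)" by metis
  have "compact (closure \<Omega>)" using \<Omega>(2) by (simp add: compact_closure)
  moreover have "closure \<Omega> \<subseteq> (\<Union>p\<in>closure \<Omega>. ball p (\<rho> p))"
    using \<rho> by force
  ultimately obtain J where J: "J \<subseteq> closure \<Omega>" "finite J" "closure \<Omega> \<subseteq> (\<Union>p\<in>J. ball p (\<rho> p))"
    using compactE_image[of "closure \<Omega>" "closure \<Omega>" "\<lambda>p. ball p (\<rho> p)"] by auto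
  show ?thesis
  proof (rule test_approximable_covered[OF s J(2) _ _ u(1,2)])
    show "u x = 0" if "x \<notin> (\<Union>p\<in>J. ball p (\<rho> p))" for x
      using that J(3) closure_subset u(3) by blast
  qed (use J(1) \<rho> u(3) in auto)
qed

text \<open>The double integral depends only on the class of \<open>u\<close> up to null sets; for a Borel representative
  the substitution \<open>x = y + z\<close> and an exchange of the integrals give the other form.\<close>

lemma gagliardo_eq_frac_seminorm:
  fixes u w :: "real ^ 'n \<Rightarrow> real"
  assumes [measurable]: "w \<in> borel_measurable borel" and ae: "AE x in lborel. u x = w x"
  shows "gagliardo s UNIV u = frac_seminorm s w"
proof -
  let ?p = "real CARD('n) + s"
  have "gagliardo s UNIV u
      = (\<integral>\<^sup>+y. \<integral>\<^sup>+x. ennreal (\<bar>u x - u y\<bar> / norm (x - y) powr ?p) \<partial>lborel \<partial>lborel)"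
    by (simp add: gagliardo_def nn_integral_completion)
  also have "\<dots> = (\<integral>\<^sup>+y. \<integral>\<^sup>+x. ennreal (\<bar>w x - w y\<bar> / norm (x - y) powr ?p) \<partial>lborel \<partial>lborel)"
  proof (rule nn_integral_cong_AE)
    show "AE y in lborel. (\<integral>\<^sup>+x. ennreal (\<bar>u x - u y\<bar> / norm (x - y) powr ?p) \<partial>lborel)
        = (\<integral>\<^sup>+x. ennreal (\<bar>w x - w y\<bar> / norm (x - y) powr ?p) \<partial>lborel)"
      using ae
    proof eventually_elim
      case (elim y)
      show ?case
        by (rule nn_integral_cong_AE) (use ae elim in \<open>auto elim!: eventually_mono\<close>)
    qed
  qed
  also have "\<dots> = (\<integral>\<^sup>+y. \<integral>\<^sup>+z. frac_kernel s z * ennreal \<bar>w (y + z) - w y\<bar> \<partial>lborel \<partial>lborel)"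
  proof (rule nn_integral_cong)
    fix y
    have "(\<integral>\<^sup>+x. ennreal (\<bar>w x - w y\<bar> / norm (x - y) powr ?p) \<partial>lborel)
        = (\<integral>\<^sup>+z. ennreal (\<bar>w (z + y) - w y\<bar> / norm ((z + y) - y) powr ?p) \<partial>lborel)"
      by (rule nn_integral_lborel_shift[symmetric]) measurable
    also have "\<dots> = (\<integral>\<^sup>+z. frac_kernel s z * ennreal \<bar>w (y + z) - w y\<bar> \<partial>lborel)"
      by (intro nn_integral_cong) (simp add: frac_kernel_def add.commute flip: ennreal_mult)
    finally show "(\<integral>\<^sup>+x. ennreal (\<bar>w x - w y\<bar> / norm (x - y) powr ?p) \<partial>lborel) = \<dots>" .
  qed
  also have "\<dots> = (\<integral>\<^sup>+z. \<integral>\<^sup>+y. frac_kernel s z * ennreal \<bar>w (y + z) - w y\<bar> \<partial>lborel \<partial>lborel)"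
    by (rule lborel_pair.Fubini') measurable
  also have "\<dots> = frac_seminorm s w"
    unfolding frac_seminorm_def L1norm_def by (intro nn_integral_cong nn_integral_cmult) measurable
  finally show ?thesis .
qed

lemma gagliardo_mono_domain: "gagliardo s A u \<le> gagliardo s UNIV u"
  unfolding gagliardo_def
  by (intro nn_integral_mono mult_mono nn_integral_mono) (auto simp: indicator_def)

lemma borel_representative:
  fixes u :: "real ^ 'n \<Rightarrow> real"
  assumes u: "u \<in> borel_measurable lebesgue" and \<Omega>: "open \<Omega>" and zero: "\<And>x. x \<notin> \<Omega> \<Longrightarrow> u x = 0"
  obtains w where "w \<in> borel_measurable borel" "AE x in lborel. u x = w x" "\<And>x. x \<notin> \<Omega> \<Longrightarrow> w x = 0"
    "(\<And>x. 0 \<le> u x) \<Longrightarrow> (\<And>x. 0 \<le> w x)"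
proof -
  obtain w0 where [measurable]: "w0 \<in> borel_measurable lborel" and ae: "AE x in lborel. u x = w0 x"
    using completion_ex_borel_measurable_real[OF u] by blast
  have [measurable]: "\<Omega> \<in> sets borel" using \<Omega> by simp
  define w where "w x = (if \<forall>x. 0 \<le> u x then max 0 (indicat_real \<Omega> x * w0 x) else indicat_real \<Omega> x * w0 x)" for x
  show ?thesis
  proof (rule that[of w])
    show "w \<in> borel_measurable borel"
      unfolding w_def[abs_def] by (cases "\<forall>x. 0 \<le> u x") simp_all
    show "AE x in lborel. u x = w x"
      using ae
    proof eventually_elim
      case (elim x)
      then have "indicat_real \<Omega> x * w0 x = u x" using zero[of x] by (cases "x \<in> \<Omega>") auto
      then show ?case by (simp add: w_def max_absorb2)
    qed
  qed (auto simp: w_def)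
qed

text \<open>The norm in the definition of \<open>Ws1_0\<close> integrates over \<open>\<Omega>\<close> only, hence is bounded by the norm over
  the whole space in which the test functions have been seen to be dense.\<close>

theorem Ws1_0_density:
  fixes u :: "real ^ 'n \<Rightarrow> real"
  assumes s: "0 < s" "s < 1" and \<Omega>: "open \<Omega>" "bounded \<Omega>" "lipschitz_boundary \<Omega>"
    and u: "u \<in> borel_measurable lebesgue" "\<And>x. x \<notin> \<Omega> \<Longrightarrow> u x = 0"
    and int: "(\<integral>\<^sup>+x. ennreal \<bar>u x\<bar> \<partial>lebesgue) < \<infinity>" and gag: "gagliardo s UNIV u < \<infinity>"
  shows "u \<in> Ws1_0 s \<Omega>"
proof -
  obtain w where w [measurable]: "w \<in> borel_measurable borel" and ae: "AE x in lborel. u x = w x"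
    and zero: "\<And>x. x \<notin> \<Omega> \<Longrightarrow> w x = 0"
    using borel_representative[OF u(1) \<Omega>(1) u(2)] by metis
  have "L1norm w = (\<integral>\<^sup>+x. ennreal \<bar>u x\<bar> \<partial>lebesgue)"
    unfolding nn_integral_completion L1norm_def
    by (rule nn_integral_cong_AE) (use ae in \<open>auto elim!: eventually_mono\<close>)
  then have "frac_norm s w < \<infinity>"
    using int gag gagliardo_eq_frac_seminorm[OF w ae, of s] by (simp add: frac_norm_def)
  then have app: "test_approximable s \<Omega> w"
    by (rule test_approximable_Lipschitz_domain[OF s \<Omega> w _ zero])
  have "\<exists>\<phi>\<in>test_functions \<Omega>. Ws1_norm s \<Omega> (\<lambda>x. u x - \<phi> x) < e" if e: "e > 0" for e
  proof -
    obtain \<phi> where \<phi>: "\<phi> \<in> test_functions \<Omega>" "frac_norm s (\<lambda>x. w x - \<phi> x) < e"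
      using app e unfolding test_approximable_def by blast
    have [measurable]: "\<phi> \<in> borel_measurable borel" by (rule test_function_borel[OF \<phi>(1)])
    have ae': "AE x in lborel. u x - \<phi> x = w x - \<phi> x"
      using ae by (auto elim!: eventually_mono)
    have "(\<integral>\<^sup>+x\<in>\<Omega>. ennreal \<bar>u x - \<phi> x\<bar> \<partial>lebesgue) \<le> L1norm (\<lambda>x. w x - \<phi> x)"
      unfolding nn_integral_completion L1norm_def
      by (rule nn_integral_mono_AE) (use ae' in \<open>auto elim!: eventually_mono simp: indicator_def\<close>)
    moreover have "gagliardo s \<Omega> (\<lambda>x. u x - \<phi> x) \<le> frac_seminorm s (\<lambda>x. w x - \<phi> x)"
    proof -
      have "gagliardo s UNIV (\<lambda>x. u x - \<phi> x) = frac_seminorm s (\<lambda>x. w x - \<phi> x)"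
        by (rule gagliardo_eq_frac_seminorm[OF _ ae']) measurable
      then show ?thesis using gagliardo_mono_domain[of s \<Omega> "\<lambda>x. u x - \<phi> x"] by simp
    qed
    ultimately have "Ws1_norm s \<Omega> (\<lambda>x. u x - \<phi> x) \<le> frac_norm s (\<lambda>x. w x - \<phi> x)"
      unfolding Ws1_norm_def frac_norm_def by (rule add_mono)
    with \<phi> show ?thesis by (intro bexI[of _ \<phi>]) auto
  qed
  then show ?thesis using u by (auto simp: Ws1_0_def)
qed

section \<open>The coarea formula\<close>

text \<open>The levels that separate \<open>a\<close> from \<open>b\<close> form an interval of length \<open>\<bar>a - b\<bar>\<close>. Only levels
  \<open>t \<ge> 0\<close> are used, because the superlevel sets of negative levels of a function vanishing outside \<open>\<Omega>\<close>
  are not contained in \<open>\<Omega>\<close>.\<close>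

lemma abs_diff_layer_cake:
  fixes a b :: real
  assumes "0 \<le> a" "0 \<le> b"
  shows "ennreal \<bar>a - b\<bar>
    = (\<integral>\<^sup>+t. indicator {0..} t * ennreal \<bar>indicat_real {t<..} a - indicat_real {t<..} b\<bar> \<partial>lborel)"
proof -
  have "ennreal \<bar>a - b\<bar> = emeasure lborel {min a b..<max a b}"
    by (simp add: min_def max_def abs_if)
  also have "\<dots> = (\<integral>\<^sup>+t. indicator {min a b..<max a b} t \<partial>lborel)"
    by simp
  also have "\<dots> = (\<integral>\<^sup>+t. indicator {0..} t * ennreal \<bar>indicat_real {t<..} a - indicat_real {t<..} b\<bar> \<partial>lborel)"
    using assms by (intro nn_integral_cong) (auto simp: indicator_def min_def max_def)
  finally show ?thesis .
qed

lemma measurable_level_seminorm: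
  fixes v :: "'a::euclidean_space \<Rightarrow> real"
  assumes [measurable]: "v \<in> borel_measurable borel"
  shows "(\<lambda>t. indicator {0..} t * frac_seminorm s (indicat_real {x. t < v x})) \<in> borel_measurable lborel"
  unfolding frac_seminorm_def L1norm_def indicator_def by measurable

proposition frac_seminorm_coarea:
  fixes v :: "'a::euclidean_space \<Rightarrow> real"
  assumes [measurable]: "v \<in> borel_measurable borel" and nn: "\<And>x. 0 \<le> v x"
  shows "frac_seminorm s v
    = (\<integral>\<^sup>+t. indicator {0..} t * frac_seminorm s (indicat_real {x. t < v x}) \<partial>lborel)"
proof -
  let ?\<chi> = "\<lambda>t x. indicat_real {t<..} (v x)"
  have [measurable (raw)]: "(\<lambda>x. ?\<chi> (a x) (b x)) \<in> borel_measurable M"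
    if [measurable]: "a \<in> borel_measurable M" "b \<in> borel_measurable M" for a b and M :: "'c measure"
    unfolding indicator_def greaterThan_iff by measurable
  have slice: "L1norm (\<lambda>x. v (x + z) - v x)
      = (\<integral>\<^sup>+t. indicator {0..} t * L1norm (\<lambda>x. ?\<chi> t (x + z) - ?\<chi> t x) \<partial>lborel)" for z
  proof -
    have "L1norm (\<lambda>x. v (x + z) - v x)
        = (\<integral>\<^sup>+x. \<integral>\<^sup>+t. indicator {0..} t * ennreal \<bar>?\<chi> t (x + z) - ?\<chi> t x\<bar> \<partial>lborel \<partial>lborel)"
      unfolding L1norm_def by (intro nn_integral_cong abs_diff_layer_cake nn)
    also have "\<dots> = (\<integral>\<^sup>+t. \<integral>\<^sup>+x. indicator {0..} t * ennreal \<bar>?\<chi> t (x + z) - ?\<chi> t x\<bar> \<partial>lborel \<partial>lborel)"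
      by (rule lborel_pair.Fubini') measurable
    finally show ?thesis
      unfolding L1norm_def by (simp add: nn_integral_cmult)
  qed
  have "frac_seminorm s v
      = (\<integral>\<^sup>+z. \<integral>\<^sup>+t. frac_kernel s z * (indicator {0..} t * L1norm (\<lambda>x. ?\<chi> t (x + z) - ?\<chi> t x)) \<partial>lborel \<partial>lborel)"
    unfolding frac_seminorm_def slice unfolding L1norm_def
    by (intro nn_integral_cong nn_integral_cmult[symmetric]) measurable
  also have "\<dots> = (\<integral>\<^sup>+t. \<integral>\<^sup>+z. frac_kernel s z * (indicator {0..} t * L1norm (\<lambda>x. ?\<chi> t (x + z) - ?\<chi> t x)) \<partial>lborel \<partial>lborel)"
    unfolding L1norm_def by (rule lborel_pair.Fubini') measurable
  also have "\<dots> = (\<integral>\<^sup>+t. indicator {0..} t * frac_seminorm s (?\<chi> t) \<partial>lborel)"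
    unfolding frac_seminorm_def L1norm_def
    by (intro nn_integral_cong, subst nn_integral_cmult[symmetric]) (auto simp: ac_simps)
  also have "(\<lambda>t. ?\<chi> t) = (\<lambda>t. indicat_real {x. t < v x})"
    by (auto simp: indicator_def fun_eq_iff)
  finally show ?thesis by (simp add: fun_eq_iff)
qed

lemma weighted_layer_cake:
  fixes f v :: "'a::euclidean_space \<Rightarrow> real"
  assumes [measurable]: "f \<in> borel_measurable borel" "v \<in> borel_measurable borel"
    and nn: "\<And>x. 0 \<le> f x" "\<And>x. 0 \<le> v x"
  shows "(\<integral>\<^sup>+x. ennreal (f x * v x) \<partial>lborel)
    = (\<integral>\<^sup>+t. indicator {0..} t * (\<integral>\<^sup>+x. ennreal (f x * indicat_real {x. t < v x} x) \<partial>lborel) \<partial>lborel)"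
proof -
  have [measurable (raw)]: "(\<lambda>x. indicat_real {a x<..} (v (b x))) \<in> borel_measurable M"
    if [measurable]: "a \<in> borel_measurable M" "b \<in> borel_measurable M" for a b and M :: "'c measure"
    unfolding indicator_def greaterThan_iff by measurable
  have "(\<integral>\<^sup>+x. ennreal (f x * v x) \<partial>lborel)
      = (\<integral>\<^sup>+x. \<integral>\<^sup>+t. indicator {0..} t * ennreal (f x * indicat_real {t<..} (v x)) \<partial>lborel \<partial>lborel)"
  proof (rule nn_integral_cong)
    fix x
    have "ennreal (f x * v x) = ennreal (f x) * ennreal \<bar>v x - 0\<bar>"
      using nn by (simp add: ennreal_mult)
    also have "\<dots> = (\<integral>\<^sup>+t. ennreal (f x) * (indicator {0..} t * ennreal \<bar>indicat_real {t<..} (v x) - indicat_real {t<..} 0\<bar>) \<partial>lborel)"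
      unfolding abs_diff_layer_cake[OF nn(2) order_refl]
      by (rule nn_integral_cmult[symmetric]) (simp add: indicator_def)
    also have "\<dots> = (\<integral>\<^sup>+t. indicator {0..} t * ennreal (f x * indicat_real {t<..} (v x)) \<partial>lborel)"
      using nn by (intro nn_integral_cong) (auto simp: indicator_def)
    finally show "ennreal (f x * v x) = (\<integral>\<^sup>+t. indicator {0..} t * ennreal (f x * indicat_real {t<..} (v x)) \<partial>lborel)" .
  qed
  also have "\<dots> = (\<integral>\<^sup>+t. \<integral>\<^sup>+x. indicator {0..} t * ennreal (f x * indicat_real {t<..} (v x)) \<partial>lborel \<partial>lborel)"
    by (rule lborel_pair.Fubini') measurable
  also have "\<dots> = (\<integral>\<^sup>+t. indicator {0..} t * (\<integral>\<^sup>+x. ennreal (f x * indicat_real {t<..} (v x)) \<partial>lborel) \<partial>lborel)"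
    by (intro nn_integral_cong nn_integral_cmult) measurable
  also have "(\<lambda>t x. indicat_real {t<..} (v x)) = (\<lambda>t. indicat_real {x. t < v x})"
    by (auto simp: indicator_def fun_eq_iff)
  finally show ?thesis by (simp add: fun_eq_iff)
qed

section \<open>The two functionals\<close>

lemma Per_eq_frac_seminorm:
  assumes "F \<in> sets borel"
  shows "Per s F = frac_seminorm s (indicat_real F) / 2"
  unfolding Per_def using assms by (subst gagliardo_eq_frac_seminorm[of "indicat_real F"]) auto

lemma extended_integral_nonneg:
  fixes \<Omega> :: "(real ^ 'n) set"
  assumes "AE x in lebesgue. x \<in> \<Omega> \<longrightarrow> 0 \<le> g x"
  shows "extended_integral \<Omega> g = enn2ereal (\<integral>\<^sup>+x\<in>\<Omega>. ennreal (g x) \<partial>lebesgue)"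
proof -
  have "(\<integral>\<^sup>+x\<in>\<Omega>. ennreal (- g x) \<partial>lebesgue) = (\<integral>\<^sup>+x. 0 \<partial>(lebesgue :: (real ^ 'n) measure))"
    by (rule nn_integral_cong_AE) (use assms in \<open>auto elim!: eventually_mono simp: indicator_def ennreal_neg\<close>)
  then show ?thesis by (simp add: extended_integral_def zero_ennreal.rep_eq)
qed

context
  fixes s :: real and \<Omega> :: "(real ^ 'n) set" and f :: "real ^ 'n \<Rightarrow> real"
  assumes \<Omega>: "open \<Omega>" and f: "set_integrable lebesgue \<Omega> f"
    and f_nonneg: "AE x in lebesgue. x \<in> \<Omega> \<longrightarrow> 0 \<le> f x"
begin

lemma weight_on_subset:
  assumes F: "F \<in> sets lebesgue" "F \<subseteq> \<Omega>"
  shows "(\<integral>\<^sup>+x\<in>\<Omega>. ennreal (f x * indicat_real F x) \<partial>lebesgue) = ennreal (set_lebesgue_integral lebesgue F f)"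
proof -
  have "set_integrable lebesgue F f" by (rule set_integrable_subset[OF f F])
  then have "ennreal (set_lebesgue_integral lebesgue F f) = (\<integral>\<^sup>+x. ennreal (indicat_real F x *\<^sub>R f x) \<partial>lebesgue)"
    unfolding set_lebesgue_integral_def set_integrable_def
    by (intro nn_integral_eq_integral[symmetric])
      (use f_nonneg F(2) in \<open>auto elim!: eventually_mono simp: indicator_def\<close>)
  also have "\<dots> = (\<integral>\<^sup>+x\<in>\<Omega>. ennreal (f x * indicat_real F x) \<partial>lebesgue)"
    using F(2) by (intro nn_integral_cong) (auto simp: indicator_def)
  finally show ?thesis by simp
qed

lemma weight_nonneg_on_subset:
  assumes "F \<subseteq> \<Omega>"
  shows "0 \<le> set_lebesgue_integral lebesgue F f"
  unfolding set_lebesgue_integral_def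
  by (rule integral_nonneg_AE) (use f_nonneg assms in \<open>auto elim!: eventually_mono simp: indicator_def\<close>)

lemma F1_indicator:
  assumes F: "F \<in> sets lebesgue" "F \<subseteq> \<Omega>"
  shows "F1 s \<Omega> f (indicat_real F) = P s f F" "integral_exists \<Omega> (\<lambda>x. f x * indicat_real F x)"
proof -
  have ae: "AE x in lebesgue. x \<in> \<Omega> \<longrightarrow> 0 \<le> f x * indicat_real F x"
    using f_nonneg by (auto elim!: eventually_mono)
  show "F1 s \<Omega> f (indicat_real F) = P s f F"
    unfolding F1_def P_def Per_def extended_integral_nonneg[OF ae] weight_on_subset[OF F]
    using weight_nonneg_on_subset[OF F(2)] by (simp add: enn2ereal_ennreal)
  show "integral_exists \<Omega> (\<lambda>x. f x * indicat_real F x)"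
    unfolding integral_exists_def weight_on_subset[OF F] by simp
qed

text \<open>By the coarea formula and the layer cake formula, the two terms of \<open>F1 s \<Omega> f v\<close> are the integrals
  over \<open>t \<ge> 0\<close> of the perimeter and of the weight of the superlevel set \<open>{x. t < v x}\<close>. This set
  lies in \<open>\<Omega>\<close>, so the first integrand dominates the second. The comparison is made between
  extended non-negative numbers before the difference is formed; it therefore also covers the case in
  which both terms are infinite.\<close>

proposition F1_nonneg_of_P_nonneg:
  assumes P: "\<And>F. F \<in> sets lebesgue \<Longrightarrow> F \<subseteq> \<Omega> \<Longrightarrow> 0 \<le> P s f F"
    and v: "v \<in> borel_measurable lebesgue" "\<And>x. x \<notin> \<Omega> \<Longrightarrow> v x = 0" "\<And>x. 0 \<le> v x"
  shows "0 \<le> F1 s \<Omega> f v"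
proof -
  obtain w where w [measurable]: "w \<in> borel_measurable borel" and vw: "AE x in lborel. v x = w x"
    and w0: "\<And>x. x \<notin> \<Omega> \<Longrightarrow> w x = 0" and wn: "\<And>x. 0 \<le> w x"
    using borel_representative[OF v(1) \<Omega> v(2)] v(3) by metis
  \<comment> \<open>The layer cake formula needs a weight that is Borel and non-negative everywhere, whereas \<open>f\<close> is
    Lebesgue measurable on \<open>\<Omega>\<close> and non-negative almost everywhere there.\<close>
  let ?f = "\<lambda>x. max 0 (indicat_real \<Omega> x * f x)"
  have f_meas: "?f \<in> borel_measurable lebesgue"
    using f unfolding set_integrable_def by (auto dest: borel_measurable_integrable)
  obtain g where g [measurable]: "g \<in> borel_measurable borel" and fg: "AE x in lborel. ?f x = g x"
    and gn: "\<And>x. 0 \<le> g x"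
    using borel_representative[OF f_meas open_UNIV] by (auto simp: max.cobounded1)
  have fg\<Omega>: "AE x in lborel. x \<in> \<Omega> \<longrightarrow> f x = g x"
    using fg f_nonneg[unfolded AE_completion_iff] by eventually_elim auto
  have level: "(\<integral>\<^sup>+x. ennreal (g x * indicat_real {x. t < w x} x) \<partial>lborel)
      \<le> frac_seminorm s (indicat_real {x. t < w x}) / 2" if "0 \<le> t" for t
  proof -
    let ?F = "{x. t < w x}"
    have F: "?F \<subseteq> \<Omega>" using w0 that by force
    have Fb: "?F \<in> sets borel" by measurable
    then have Fl: "?F \<in> sets lebesgue" by (simp add: sets_completionI_sets)
    have "(\<integral>\<^sup>+x. ennreal (g x * indicat_real ?F x) \<partial>lborel)
        = (\<integral>\<^sup>+x\<in>\<Omega>. ennreal (f x * indicat_real ?F x) \<partial>lebesgue)"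
      unfolding nn_integral_completion
      by (rule nn_integral_cong_AE) (use fg\<Omega> F in \<open>auto elim!: eventually_mono simp: indicator_def\<close>)
    also have "\<dots> = ennreal (set_lebesgue_integral lebesgue ?F f)"
      by (rule weight_on_subset[OF Fl F])
    also have "\<dots> \<le> Per s ?F"
    proof -
      have "ereal (set_lebesgue_integral lebesgue ?F f) \<le> enn2ereal (Per s ?F)"
        using P[OF Fl F] unfolding P_def by (cases "enn2ereal (Per s ?F)") auto
      then show ?thesis
        using weight_nonneg_on_subset[OF F] by (simp add: less_eq_ennreal.rep_eq enn2ereal_ennreal)
    qed
    finally show ?thesis by (simp add: Per_eq_frac_seminorm[OF Fb])
  qed
  have "(\<integral>\<^sup>+x\<in>\<Omega>. ennreal (f x * v x) \<partial>lebesgue) = (\<integral>\<^sup>+x. ennreal (g x * w x) \<partial>lborel)"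
    unfolding nn_integral_completion
  proof (rule nn_integral_cong_AE)
    show "AE x in lborel. ennreal (f x * v x) * indicator \<Omega> x = ennreal (g x * w x)"
      using fg\<Omega> vw
    proof eventually_elim
      case (elim x)
      then show ?case using w0[of x] by (cases "x \<in> \<Omega>") auto
    qed
  qed
  also have "\<dots> \<le> (\<integral>\<^sup>+t. indicator {0..} t * (frac_seminorm s (indicat_real {x. t < w x}) / 2) \<partial>lborel)"
    unfolding weighted_layer_cake[OF g w gn wn]
    by (intro nn_integral_mono) (auto simp: level split: split_indicator)
  also have "\<dots> = (\<integral>\<^sup>+t. (indicator {0..} t * frac_seminorm s (indicat_real {x. t < w x})) / 2 \<partial>lborel)"
    by (simp add: ennreal_times_divide)
  also have "\<dots> = frac_seminorm s w / 2"
    unfolding frac_seminorm_coarea[OF w wn]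
    by (rule nn_integral_divide) (rule measurable_level_seminorm[OF w])
  also have "frac_seminorm s w = gagliardo s UNIV v"
    by (rule gagliardo_eq_frac_seminorm[OF w vw, symmetric])
  finally have le: "(\<integral>\<^sup>+x\<in>\<Omega>. ennreal (f x * v x) \<partial>lebesgue) \<le> gagliardo s UNIV v / 2" .
  have ae: "AE x in lebesgue. x \<in> \<Omega> \<longrightarrow> 0 \<le> f x * v x"
    using f_nonneg v(3) by (auto elim!: eventually_mono)
  show ?thesis
    unfolding F1_def extended_integral_nonneg[OF ae]
    using le by (intro ereal_diff_positive) (simp add: less_eq_ennreal.rep_eq)
qed

end

text \<open>Makes sets of finite perimeter admissible as competitors. Their indicators are integrable because
  \<open>\<Omega>\<close> is bounded.\<close>

lemma indicator_in_Ws1_0: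
  fixes F :: "(real ^ 'n) set"
  assumes s: "0 < s" "s < 1" and \<Omega>: "open \<Omega>" "bounded \<Omega>" "lipschitz_boundary \<Omega>"
    and F: "F \<in> sets lebesgue" "F \<subseteq> \<Omega>" and Per: "Per s F < \<infinity>"
  shows "indicat_real F \<in> Ws1_0 s \<Omega>"
proof (rule Ws1_0_density[OF s \<Omega>])
  show "indicat_real F \<in> borel_measurable lebesgue" using F(1) by simp
  show "indicat_real F x = 0" if "x \<notin> \<Omega>" for x using that F(2) by (auto simp: indicator_def)
  have "F \<in> lmeasurable"
    using bounded_subset[OF \<Omega>(2) F(2)] F(1) by (rule bounded_set_imp_lmeasurable)
  then show "(\<integral>\<^sup>+x. ennreal \<bar>indicat_real F x\<bar> \<partial>lebesgue) < \<infinity>"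
    using F(1) by (simp add: ennreal_indicator fmeasurable_def)
  show "gagliardo s UNIV (indicat_real F) < \<infinity>"
  proof (rule ccontr)
    assume "\<not> ?thesis"
    then have "gagliardo s UNIV (indicat_real F) = top" by (metis infinity_ennreal_def top.not_eq_extremum)
    then show False using Per by (simp add: Per_def ennreal_top_divide)
  qed
qed

theorem proposition4p3:
  fixes s :: real and \<Omega> :: "(real ^ 'n) set" and f :: "real ^ 'n \<Rightarrow> real"
  assumes "0 < s" "s < 1"
    and "open \<Omega>" "bounded \<Omega>" "lipschitz_boundary \<Omega>"
    and "set_integrable lebesgue \<Omega> f"
    and "AE x in lebesgue. x \<in> \<Omega> \<longrightarrow> 0 \<le> f x"
  shows "(\<forall>E. E \<subseteq> \<Omega> \<longrightarrow> F1_minimizer s \<Omega> f (indicat_real E) \<longrightarrow> P_minimizer s \<Omega> f E) \<and>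
    (\<forall>E. P_minimizer s \<Omega> f E \<longrightarrow> 0 \<le> P s f E \<longrightarrow> F1_nonneg_minimizer s \<Omega> f (indicat_real E))"
proof (intro conjI allI impI)
  note F1_eq = F1_indicator[OF assms(3,6,7)]
  note in_Ws1_0 = indicator_in_Ws1_0[OF assms(1-5)]
  fix E
  assume E: "E \<subseteq> \<Omega>" and min: "F1_minimizer s \<Omega> f (indicat_real E)"
  have "indicat_real E \<in> borel_measurable lebesgue"
    using min by (simp add: F1_minimizer_def Ws1_0_def)
  then have El: "E \<in> sets lebesgue"
    by (simp add: borel_measurable_indicator_iff)
  have "P s f E \<le> P s f F" if F: "F \<in> sets lebesgue" "F \<subseteq> \<Omega>" for F
  proof (cases "Per s F < \<infinity>")
    case True
    then have "F1 s \<Omega> f (indicat_real E) \<le> F1 s \<Omega> f (indicat_real F)"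
      using min in_Ws1_0[OF F] F1_eq(2)[OF F] unfolding F1_minimizer_def by blast
    then show ?thesis by (simp only: F1_eq(1)[OF F] F1_eq(1)[OF El E])
  next
    case False
    then have "Per s F = top" by (metis infinity_ennreal_def top.not_eq_extremum)
    then show ?thesis by (simp add: P_def)
  qed
  then show "P_minimizer s \<Omega> f E" using E El by (simp add: P_minimizer_def)
next
  note F1_eq = F1_indicator[OF assms(3,6,7)]
  fix E
  assume min: "P_minimizer s \<Omega> f E" and nonneg: "0 \<le> P s f E"
  then have E: "E \<in> sets lebesgue" "E \<subseteq> \<Omega>" and le: "\<And>F. F \<in> sets lebesgue \<Longrightarrow> F \<subseteq> \<Omega> \<Longrightarrow> P s f E \<le> P s f F"
    by (auto simp: P_minimizer_def)
  have "P s f {} = 0"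
    by (simp add: P_def Per_def gagliardo_def set_lebesgue_integral_def zero_ennreal.rep_eq flip: zero_ereal_def)
  then have P0: "P s f E = 0" using le[of "{}"] nonneg by simp
  then have P_nonneg: "0 \<le> P s f F" if "F \<in> sets lebesgue" "F \<subseteq> \<Omega>" for F
    using le[OF that] by simp
  have "Per s E \<noteq> top"
  proof
    assume "Per s E = top"
    then have "P s f E = \<infinity>" by (simp add: P_def)
    with P0 show False by simp
  qed
  then have "indicat_real E \<in> Ws1_0 s \<Omega>"
    using indicator_in_Ws1_0[OF assms(1-5) E] by (simp add: less_top)
  moreover have "F1 s \<Omega> f (indicat_real E) \<le> F1 s \<Omega> f v"
    if "v \<in> Ws1_0 s \<Omega>" "\<forall>x. 0 \<le> v x" for v
  proof -
    have "0 \<le> F1 s \<Omega> f v"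
      using that by (intro F1_nonneg_of_P_nonneg[OF assms(3,6,7) P_nonneg]) (auto simp: Ws1_0_def)
    then show ?thesis by (simp add: F1_eq(1)[OF E] P0)
  qed
  ultimately show "F1_nonneg_minimizer s \<Omega> f (indicat_real E)"
    by (simp add: F1_nonneg_minimizer_def)
qed

end
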